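(* Let $S$ be a Dirac node on $(\mathcal E,\mathcal X,\mathcal F)$ with bounded control, observation and feedthrough, i.e., $\mathcal F=\mathcal E$, $\psi=I$, $\mathrm{dom}(S)=\mathrm{dom}(A)\times\mathcal E$ and $S=\begin{bmatrix}A&B\\C&D\end{bmatrix}$, where $A:\mathcal X\supset\mathrm{dom}(A)\to\mathcal X$ is linear, $B\in\mathcal L(\mathcal E,\mathcal X)$, $C\in\mathcal L(\mathcal X,\mathcal E)$ and $D\in\mathcal L(\mathcal E)$. Then $\begin{bmatrix}A&B\\C&D\end{bmatrix}$ is a system node. If additionally $P,G:[0,\infty)\to\mathcal L(\mathcal X)$ satisfy, for all $t\ge0$ and all $z\in\mathcal X$: $P(t)=P(t)^*\ge 0$; $P(t)$ has an inverse in $\mathcal L(\mathcal X)$; $P(\cdot)z\in C^2([0,\infty);\mathcal X)$; $P(\cdot)^{-1}z,\,G(\cdot)z\in C^1([0,\infty);\mathcal X)$, then (with $\mathcal V$ and $\mathcal V^\times$ as defined in the context, for a fixed $\beta\in\mathbb C_+$ such that $(x,e)\mapsto(x,\beta e+Cx+De)$ is injective on $\mathrm{dom}(S)$) $$\mathcal V=\mathcal V^\times=\begin{bmatrix}P(0)^{-1}\mathrm{dom}(A)\\ H^1_{loc}([0,\infty);\mathcal E)\end{bmatrix},$$ i.e., for all $x_0\in P(0)^{-1}\mathrm{dom}(A)$ and $e\in H^1_{loc}([0,\infty);\mathcal E)$ there exist unique $x$ and $f$ such that $(e,x,f)$ is a classical solution on $[0,\infty)$ with $x(0)=x_0$ of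 $$\begin{bmatrix}\dot x(t)\\ f(t)\end{bmatrix}=\left(\begin{bmatrix}A&B\\ C&D\end{bmatrix}+\begin{bmatrix}G(t)P(t)^{-1}&0\\0&0\end{bmatrix}\right)\begin{bmatrix}P(t)x(t)\\ e(t)\end{bmatrix},\qquad t\ge 0.\qquad(\ast)$$
   Context: $\mathcal X,\mathcal E$ are (both complex or both real) Hilbert spaces; $\mathcal L(\cdot,\cdot)$ denotes bounded linear operators. $\mathbb C_+:=\{z\in\mathbb C:\mathrm{Re}\,z>0\}$; for real spaces $\beta$ is understood to be in $(0,\infty)$. $\mathbb R_+:=[0,\infty)$. A linear operator $T$ on a Hilbert space is dissipative if $\mathrm{Re}\langle Th,h\rangle\le 0$ for all $h\in\mathrm{dom}(T)$, and maximal dissipative if moreover $\lambda I-T$ is onto for some (equivalently all) $\lambda>0$. In general, for Hilbert spaces $\mathcal E,\mathcal F$ that are dual with unitary duality map $\psi:\mathcal F\to\mathcal E$, a Dirac node on $(\mathcal E,\mathcal X,\mathcal F)$ is a linear operator $S=\begin{bmatrix}A\&B\\ C\&D\end{bmatrix}:\mathcal X\times\mathcal E\supset\mathrm{dom}(S)\to\mathcal X\times\mathcal F$ such that $\begin{bmatrix}A\&B\\-\psi C\&D\end{bmatrix}$, with domain $\mathrm{dom}(S)$, is maximal dissipative on $\mathcal X\times\mathcal E$, and such that for some $\beta\in\mathbb C_+$ the map $(x,e)\mapsto(x,\beta e+\psi\,C\&D(x,e))$ is injective on $\mathrm{dom}(S)$. In the claim, $\mathcal F=\mathcal E$ and $\psi=I$.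 A system node on $(\mathcal E,\mathcal X,\mathcal F)$ is a closed linear operator $\begin{bmatrix}A\&B\\ C\&D\end{bmatrix}:\mathcal X\times\mathcal E\supset\mathcal D\to\mathcal X\times\mathcal F$ such that: (1) $A\&B:\mathcal X\times\mathcal E\supset\mathcal D\to\mathcal X$ is closed; (2) the main operator $Ax:=A\&B(x,0)$, $\mathrm{dom}(A)=\{x:(x,0)\in\mathcal D\}$, generates a $C_0$-semigroup on $\mathcal X$; (3) for every $e\in\mathcal E$ there is $x\in\mathcal X$ with $(x,e)\in\mathcal D$. A classical solution of $(\ast)$ is a triple $(e,x,f)\in H^1_{loc}(\mathbb R_+;\mathcal E)\times C^1(\mathbb R_+;\mathcal X)\times H^1_{loc}(\mathbb R_+;\mathcal E)$ such that $(P(t)x(t),e(t))\in\mathrm{dom}(S)$ and $(\ast)$ holds for all $t\ge 0$. External Cayley transform (with $C\&D(x,e)=Cx+De$, $A\&B(x,e)=Ax+Be$, $\psi=I$): $$S^\times:=\begin{bmatrix}\sqrt{2\mathrm{Re}\beta}\,A\&B\\ \begin{bmatrix}0&\overline\beta I\end{bmatrix}-\psi C\&D\end{bmatrix}\begin{bmatrix}\sqrt{2\mathrm{Re}\beta}\begin{bmatrix}I&0\end{bmatrix}\\ \begin{bmatrix}0&\beta I\end{bmatrix}+\psi C\&D\end{bmatrix}^{-1},\qquad \mathrm{dom}(S^\times):=\begin{bmatrix}\sqrt{2\mathrm{Re}\beta}\begin{bmatrix}I&0\end{bmatrix}\\ \begin{bmatrix}0&\beta I\end{bmatrix}+\psi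 C\&D\end{bmatrix}\mathrm{dom}(S).$$ The scattering representation is $$\begin{bmatrix}\dot x(t)\\ y(t)\end{bmatrix}=\left(S^\times+\begin{bmatrix}G(t)P(t)^{-1}&0\\0&0\end{bmatrix}\right)\begin{bmatrix}P(t)x(t)\\ u(t)\end{bmatrix},\quad t\ge0,\qquad(\ast\ast)$$ obtained from $(\ast)$ by $u=(\beta e+\psi f)/\sqrt{2\mathrm{Re}\beta}$, $y=(\overline\beta e-\psi f)/\sqrt{2\mathrm{Re}\beta}$, equivalently $e=(u+y)/\sqrt{2\mathrm{Re}\beta}$, $f=(\overline\beta\psi^*u-\beta\psi^*y)/\sqrt{2\mathrm{Re}\beta}$. Its classical solutions $(u,x,y)\in H^1_{loc}(\mathbb R_+;\mathcal E)\times C^1(\mathbb R_+;\mathcal X)\times H^1_{loc}(\mathbb R_+;\mathcal E)$ are defined analogously, with $(P(t)x(t),u(t))\in\mathrm{dom}(S^\times)$. Put $$\mathcal V^\times:=\{(x_0,u)\in\mathcal X\times H^1_{loc}(\mathbb R_+;\mathcal E):\ (P(0)x_0,u(0))\in\mathrm{dom}(S^\times)\}.$$ A time-varying well-posed system on $\mathbb R_+$ with Hilbert input, state and output spaces $(\mathcal U,\mathcal X,\mathcal Y)$ is a quadruple of families of bounded operators, indexed by $(t,r)$ with $t\ge r\ge0$, $\mathbb T(t,r):\mathcal X\to\mathcal X$, $\Phi(t,r):L^2(\mathbb R_+;\mathcal U)\to\mathcal X$, $\Psi(t,r):\mathcal X\to L^2(\mathbb R_+;\mathcal Y)$, $\mathbb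 F(t,r):L^2(\mathbb R_+;\mathcal U)\to L^2(\mathbb R_+;\mathcal Y)$, such that, with $\mathbf P_{[r,t]}$ denoting multiplication by the indicator function of $[r,t]$: (1) $\mathbb T$ is an evolution family, i.e. $\mathbb T(t,t)=I$, $\mathbb T(t,s)\mathbb T(s,r)=\mathbb T(t,r)$, and $\mathbb T$ is jointly strongly continuous; (2) $\Phi(t,r)=\Phi(t,r)\mathbf P_{[r,t]}$, $\Psi(t,r)=\mathbf P_{[r,t]}\Psi(t,r)$, $\mathbb F(t,r)=\mathbf P_{[r,t]}\mathbb F(t,r)=\mathbb F(t,r)\mathbf P_{[r,t]}$; (3) all four families are locally uniformly bounded; (4) for $t\ge s\ge r\ge0$: $\Phi(t,r)=\Phi(t,s)+\mathbb T(t,s)\Phi(s,r)$, $\Psi(t,r)=\Psi(t,s)\mathbb T(s,r)+\Psi(s,r)$, $\mathbb F(t,r)=\mathbb F(t,s)+\mathbb F(s,r)+\Psi(t,s)\Phi(s,r)$. Its mild solution with initial state $x_0$ and input $u\in L^2_{loc}(\mathbb R_+;\mathcal U)$ is the triple $(u,x,y)\in L^2_{loc}(\mathbb R_+;\mathcal U)\times C(\mathbb R_+;\mathcal X)\times L^2_{loc}(\mathbb R_+;\mathcal Y)$ with $x(t)=\mathbb T(t,0)x_0+\Phi(t,0)u$, $\mathbf P_{[0,t]}y=\Psi(t,0)x_0+\mathbb F(t,0)u$ for $t\ge0$ (by causality, $u$ may be replaced by $\mathbf P_{[0,t]}u$). Known fact: for a Dirac node $S$, such $\beta$, and $P,G$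 as in the claim, there is a time-varying well-posed system $(\mathbb T,\Phi,\Psi,\mathbb F)$ with spaces $(\mathcal E,\mathcal X,\mathcal E)$ such that for every $(x_0,u)\in\mathcal V^\times$ there is a unique classical solution $(u,x,y)$ of $(\ast\ast)$ with $x(0)=x_0$ and input $u$, with $y\in H^1_{loc}(\mathbb R_+;\mathcal E)$, and $(u,x,y)$ is also the unique mild solution of $(\mathbb T,\Phi,\Psi,\mathbb F)$ with initial state $x_0$ and input $u$. With $\Psi^\times:=\Psi$, $\mathbb F^\times:=\mathbb F$ from this system, define (limit in $\mathcal X\times L^2_{loc}(\mathbb R_+;\mathcal E)$) $$\mathcal V:=\lim_{t\to\infty}\begin{bmatrix}\sqrt{2\mathrm{Re}\beta}\,I&0\\ \Psi^\times(t,0)&I+\mathbb F^\times(t,0)\mathbf P_{[0,t]}\end{bmatrix}\mathcal V^\times,$$ i.e. $\mathcal V$ is the set of limits as $t\to\infty$ of $\big(\sqrt{2\mathrm{Re}\beta}\,x_0,\ \Psi^\times(t,0)x_0+u+\mathbb F^\times(t,0)\mathbf P_{[0,t]}u\big)$, where $(x_0,u)$ ranges over $\mathcal V^\times$. *)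

theory Defs
  imports "HOL-Analysis.Analysis"
begin

section \<open>Scalars: the real or the complex numbers\<close>

text \<open>
  The axioms force every instance to be a copy of the reals or of the complex numbers
  (see \<open>rc_scalar_cases\<close> below), so that a statement over \<open>'k::rc_scalar\<close> is
  a statement about real and about complex Hilbert spaces simultaneously.
\<close>

class rc_scalar = real_normed_field +
  fixes rc_conj :: "'a \<Rightarrow> 'a"
    and rc_re :: "'a \<Rightarrow> real"
  assumes rc_conj_add: "rc_conj (x + y) = rc_conj x + rc_conj y"
    and rc_conj_mult: "rc_conj (x * y) = rc_conj x * rc_conj y"
    and rc_conj_scaleR_1: "rc_conj (r *\<^sub>R 1) = r *\<^sub>R 1"
    and rc_conj_conj: "rc_conj (rc_conj x) = x"
    and rc_add_conj_1: "x + rc_conj x = (2 * rc_re x) *\<^sub>R 1"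
    and rc_mult_conj_1: "x * rc_conj x = (norm x)\<^sup>2 *\<^sub>R 1"

instantiation real :: rc_scalar
begin
definition "rc_conj (x::real) = x"
definition "rc_re (x::real) = x"
instance
  by standard (auto simp: rc_conj_real_def rc_re_real_def power2_eq_square)
end

instantiation complex :: rc_scalar
begin
definition "rc_conj (z::complex) = cnj z"
definition "rc_re (z::complex) = Re z"
instance
proof
  fix x y :: complex and r :: real
  show "x * rc_conj x = (norm x)\<^sup>2 *\<^sub>R 1"
    by (simp add: rc_conj_complex_def scaleR_conv_of_real flip: complex_norm_square)
  show "x + rc_conj x = (2 * rc_re x) *\<^sub>R 1"
    by (simp add: rc_conj_complex_def rc_re_complex_def complex_add_cnj scaleR_conv_of_real)
qed (simp_all add: rc_conj_complex_def)
end

lemma rc_conj_of_real: "rc_conj (of_real r :: 'k::rc_scalar) = of_real r"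
  unfolding of_real_def by (rule rc_conj_scaleR_1)

lemma rc_add_conj: "x + rc_conj x = (of_real (2 * rc_re x) :: 'k::rc_scalar)"
  unfolding of_real_def by (rule rc_add_conj_1)

lemma rc_mult_conj: "x * rc_conj x = (of_real ((norm x)\<^sup>2) :: 'k::rc_scalar)"
  unfolding of_real_def by (rule rc_mult_conj_1)

lemma rc_scalar_cases:
  "(\<forall>z::'k::rc_scalar. z = of_real (rc_re z)) \<or>
   (\<exists>i::'k. i * i = -1 \<and> rc_conj i = - i \<and>
      (\<forall>z. \<exists>b. z = of_real (rc_re z) + of_real b * i))"
proof (cases "\<forall>z::'k. z = of_real (rc_re z)")
  case True
  then show ?thesis by blast
next
  case False
  then obtain w :: 'k where w: "w \<noteq> of_real (rc_re w)" by blast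
  define im where "im = (\<lambda>z::'k. z - of_real (rc_re z))"
  have conj_im: "rc_conj (im z) = - im z" for z
  proof -
    have "rc_conj (im z) + of_real (rc_re z) = rc_conj z"
      using rc_conj_add[of "im z" "of_real (rc_re z)"] by (simp add: im_def rc_conj_of_real)
    moreover have "rc_conj z = of_real (2 * rc_re z) - z"
      using rc_add_conj[of z] by (metis add_diff_cancel_left')
    ultimately show ?thesis by (simp add: im_def algebra_simps)
  qed
  have sq_im: "im z * im z = - of_real ((norm (im z))\<^sup>2)" for z
    using rc_mult_conj[of "im z"] conj_im[of z] by (metis minus_minus mult_minus_right)
  define i where "i = im w / of_real (norm (im w))"
  have nz: "norm (im w) \<noteq> 0" using w by (simp add: im_def)
  have ii: "i * i = -1"
    using sq_im[of w] nz by (simp add: i_def power2_eq_square)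
  have wi: "im w = of_real (norm (im w)) * i" using nz by (simp add: i_def)
  have "rc_conj (im w) = of_real (norm (im w)) * rc_conj i"
    by (subst wi) (simp add: rc_conj_mult rc_conj_of_real)
  then have "of_real (norm (im w)) * rc_conj i = of_real (norm (im w)) * (- i)"
    using conj_im[of w] wi by simp
  then have ci: "rc_conj i = - i" using nz by (metis mult_left_cancel of_real_eq_0_iff)
  have "\<exists>b. z = of_real (rc_re z) + of_real b * i" for z
  proof -
    define b where "b = norm (im z)"
    have "(im z - of_real b * i) * (im z + of_real b * i) = im z * im z - of_real (b\<^sup>2) * (i * i)"
      by (simp add: algebra_simps power2_eq_square)
    also have "\<dots> = 0" using sq_im[of z] ii by (simp add: b_def)
    finally have "im z = of_real b * i \<or> im z = of_real (- b) * i"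
      by (auto simp: add_eq_0_iff2)
    then obtain c where "im z = of_real c * i" by blast
    then have "z = of_real (rc_re z) + of_real c * i" by (simp add: im_def diff_eq_eq add.commute)
    then show ?thesis by blast
  qed
  then show ?thesis using ii ci by blast
qed

section \<open>Hilbert spaces and operators\<close>

text \<open>
  The type supplies the complete norm; the record supplies the scalar multiplication
  and the inner product (linear in its first argument) inducing that norm.
\<close>

record ('k, 'a) inner_structure =
  scal :: "'k \<Rightarrow> 'a \<Rightarrow> 'a"
  ip :: "'a \<Rightarrow> 'a \<Rightarrow> 'k"

definition hilbert_space :: "('k::rc_scalar, 'a::banach) inner_structure \<Rightarrow> bool" where
  "hilbert_space H \<longleftrightarrow>
     vector_space (scal H) \<and>
     (\<forall>r x. scal H (of_real r) x = r *\<^sub>R x) \<and>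
     (\<forall>x y z. ip H (x + y) z = ip H x z + ip H y z) \<and>
     (\<forall>c x y. ip H (scal H c x) y = c * ip H x y) \<and>
     (\<forall>x y. ip H y x = rc_conj (ip H x y)) \<and>
     (\<forall>x. (norm x)\<^sup>2 = rc_re (ip H x x))"

lemma hilbert_space_real:
  "hilbert_space \<lparr> scal = scaleR, ip = (inner :: 'a::{real_inner, banach} \<Rightarrow> 'a \<Rightarrow> real) \<rparr>"
  by (auto simp: hilbert_space_def inner_add_left rc_conj_real_def
      rc_re_real_def power2_norm_eq_inner real_vector.vector_space_axioms intro: inner_commute)

lemma hilbert_space_complex:
  "hilbert_space \<lparr> scal = (*), ip = (\<lambda>x y :: complex. x * cnj y) \<rparr>"
proof -
  have "vector_space ((*) :: complex \<Rightarrow> complex \<Rightarrow> complex)"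
    by unfold_locales (auto simp: algebra_simps)
  then show ?thesis
    by (auto simp: hilbert_space_def rc_conj_complex_def rc_re_complex_def distrib_right
        scaleR_conv_of_real cmod_power2 power2_eq_square[of "Re _"] power2_eq_square[of "Im _"])
qed

definition prod_space ::
  "('k::rc_scalar, 'a::banach) inner_structure \<Rightarrow> ('k, 'b::banach) inner_structure \<Rightarrow>
   ('k, 'a \<times> 'b) inner_structure" where
  "prod_space H K =
     \<lparr> scal = (\<lambda>c (x, y). (scal H c x, scal K c y)),
       ip = (\<lambda>(x, y) (x', y'). ip H x x' + ip K y y') \<rparr>"

lemma rc_re_add: "rc_re (x + y) = rc_re x + rc_re (y::'k::rc_scalar)"
proof -
  have "(of_real (2 * rc_re (x + y)) :: 'k) = of_real (2 * rc_re x + 2 * rc_re y)"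
    unfolding of_real_add rc_add_conj[symmetric] by (simp add: rc_conj_add)
  then show ?thesis by (simp only: of_real_eq_iff)
qed

lemma hilbert_space_prod:
  assumes "hilbert_space H" "hilbert_space K"
  shows "hilbert_space (prod_space H K)"
proof -
  have H: "vector_space (scal H)" "\<And>r x. scal H (of_real r) x = r *\<^sub>R x"
    "\<And>x y z. ip H (x + y) z = ip H x z + ip H y z" "\<And>c x y. ip H (scal H c x) y = c * ip H x y"
    "\<And>x. rc_re (ip H x x) = (norm x)\<^sup>2"
    and H_sym: "\<And>x y. ip H y x = rc_conj (ip H x y)"
    using assms(1) unfolding hilbert_space_def by metis+
  have K: "vector_space (scal K)" "\<And>r x. scal K (of_real r) x = r *\<^sub>R x"
    "\<And>x y z. ip K (x + y) z = ip K x z + ip K y z" "\<And>c x y. ip K (scal K c x) y = c * ip K x y"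
    "\<And>x. rc_re (ip K x x) = (norm x)\<^sup>2"
    and K_sym: "\<And>x y. ip K y x = rc_conj (ip K x y)"
    using assms(2) unfolding hilbert_space_def by metis+
  interpret H: vector_space "scal H" by (fact H(1))
  interpret K: vector_space "scal K" by (fact K(1))
  have "vector_space (scal (prod_space H K))"
    by unfold_locales
      (auto simp: prod_space_def H.scale_right_distrib K.scale_right_distrib
        H.scale_left_distrib K.scale_left_distrib)
  moreover have "(norm w)\<^sup>2 = rc_re (ip (prod_space H K) w w)" for w
    by (simp add: prod_space_def norm_prod_def split_beta rc_re_add H K)
  moreover have "ip (prod_space H K) w v = rc_conj (ip (prod_space H K) v w)" for v w
    using H_sym[of "fst w" "fst v"] K_sym[of "snd w" "snd v"]
    by (simp add: prod_space_def split_beta rc_conj_add)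
  moreover have "scal (prod_space H K) (of_real r) w = r *\<^sub>R w" for r w
    by (simp add: prod_space_def split_beta H K prod_eq_iff)
  moreover have "ip (prod_space H K) (v + w) z = ip (prod_space H K) v z + ip (prod_space H K) w z"
    for v w z
    by (simp add: prod_space_def split_beta H K)
  moreover have "ip (prod_space H K) (scal (prod_space H K) c w) z = c * ip (prod_space H K) w z"
    for c w z
    by (simp add: prod_space_def split_beta H K distrib_left)
  ultimately show ?thesis
    unfolding hilbert_space_def by blast
qed

definition bounded_op ::
  "('k::rc_scalar, 'a::banach) inner_structure \<Rightarrow> ('k, 'b::banach) inner_structure \<Rightarrow>
   ('a \<Rightarrow> 'b) \<Rightarrow> bool" where
  "bounded_op H K T \<longleftrightarrow> Vector_Spaces.linear (scal H) (scal K) T \<and> bounded_linear T"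

text \<open>
  A possibly unbounded operator is a total function together with its domain \<open>D\<close>; its values
  outside \<open>D\<close> are irrelevant.
\<close>

definition linear_op ::
  "('k::rc_scalar, 'a::banach) inner_structure \<Rightarrow> ('k, 'b::banach) inner_structure \<Rightarrow>
   'a set \<Rightarrow> ('a \<Rightarrow> 'b) \<Rightarrow> bool" where
  "linear_op H K D T \<longleftrightarrow>
     module.subspace (scal H) D \<and>
     (\<forall>x\<in>D. \<forall>y\<in>D. T (x + y) = T x + T y) \<and>
     (\<forall>c. \<forall>x\<in>D. T (scal H c x) = scal K c (T x))"

definition closed_op :: "'a::banach set \<Rightarrow> ('a \<Rightarrow> 'b::banach) \<Rightarrow> bool" where
  "closed_op D T \<longleftrightarrow> closed ((\<lambda>x. (x, T x)) ` D)"

definition dissipative ::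
  "('k::rc_scalar, 'a::banach) inner_structure \<Rightarrow> 'a set \<Rightarrow> ('a \<Rightarrow> 'a) \<Rightarrow> bool" where
  "dissipative H D T \<longleftrightarrow> linear_op H H D T \<and> (\<forall>h\<in>D. rc_re (ip H (T h) h) \<le> 0)"

definition maximal_dissipative ::
  "('k::rc_scalar, 'a::banach) inner_structure \<Rightarrow> 'a set \<Rightarrow> ('a \<Rightarrow> 'a) \<Rightarrow> bool" where
  "maximal_dissipative H D T \<longleftrightarrow>
     dissipative H D T \<and> (\<exists>l>0. (\<lambda>h. l *\<^sub>R h - T h) ` D = UNIV)"

definition unitary_op ::
  "('k::rc_scalar, 'a::banach) inner_structure \<Rightarrow> ('k, 'b::banach) inner_structure \<Rightarrow>
   ('a \<Rightarrow> 'b) \<Rightarrow> bool" where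
  "unitary_op H K T \<longleftrightarrow>
     bounded_op H K T \<and> surj T \<and> (\<forall>x y. ip K (T x) (T y) = ip H x y)"

definition positive_op ::
  "('k::rc_scalar, 'a::banach) inner_structure \<Rightarrow> ('a \<Rightarrow> 'a) \<Rightarrow> bool" where
  "positive_op H T \<longleftrightarrow>
     bounded_op H H T \<and> (\<forall>x y. ip H (T x) y = ip H x (T y)) \<and> (\<forall>x. 0 \<le> rc_re (ip H (T x) x))"

definition C0_semigroup ::
  "('k::rc_scalar, 'a::banach) inner_structure \<Rightarrow> (real \<Rightarrow> 'a \<Rightarrow> 'a) \<Rightarrow> bool" where
  "C0_semigroup H T \<longleftrightarrow>
     (\<forall>t\<ge>0. bounded_op H H (T t)) \<and>
     T 0 = id \<and>
     (\<forall>s\<ge>0. \<forall>t\<ge>0. T (s + t) = T s \<circ> T t) \<and>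
     (\<forall>x. ((\<lambda>t. T t x) \<longlongrightarrow> x) (at_right 0))"

definition generates_C0_semigroup ::
  "('k::rc_scalar, 'a::banach) inner_structure \<Rightarrow> 'a set \<Rightarrow> ('a \<Rightarrow> 'a) \<Rightarrow> bool" where
  "generates_C0_semigroup H D A \<longleftrightarrow>
     (\<exists>T. C0_semigroup H T \<and>
        (\<forall>x z. (x \<in> D \<and> A x = z) \<longleftrightarrow>
               ((\<lambda>h. (T h x - x) /\<^sub>R h) \<longlongrightarrow> z) (at_right 0)))"

section \<open>Dirac nodes and system nodes\<close>

record ('x, 'e, 'f) node =
  ndom :: "('x \<times> 'e) set"
  AB :: "'x \<times> 'e \<Rightarrow> 'x"
  CD :: "'x \<times> 'e \<Rightarrow> 'f"

definition system_node ::
  "('k::rc_scalar, 'e::banach) inner_structure \<Rightarrow> ('k, 'x::banach) inner_structure \<Rightarrow>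
   ('k, 'f::banach) inner_structure \<Rightarrow> ('x, 'e, 'f) node \<Rightarrow> bool" where
  "system_node E X F S \<longleftrightarrow>
     linear_op (prod_space X E) (prod_space X F) (ndom S) (\<lambda>w. (AB S w, CD S w)) \<and>
     closed_op (ndom S) (\<lambda>w. (AB S w, CD S w)) \<and>
     closed_op (ndom S) (AB S) \<and>
     generates_C0_semigroup X {x. (x, 0) \<in> ndom S} (\<lambda>x. AB S (x, 0)) \<and>
     (\<forall>e. \<exists>x. (x, e) \<in> ndom S)"

definition cayley_injective ::
  "('k::rc_scalar, 'e::banach) inner_structure \<Rightarrow> ('f \<Rightarrow> 'e) \<Rightarrow> 'k \<Rightarrow> ('x, 'e, 'f) node \<Rightarrow> bool" where
  "cayley_injective E \<psi> \<beta> S \<longleftrightarrow>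
     inj_on (\<lambda>(x, e). (x, scal E \<beta> e + \<psi> (CD S (x, e)))) (ndom S)"

definition dirac_node ::
  "('k::rc_scalar, 'e::banach) inner_structure \<Rightarrow> ('k, 'x::banach) inner_structure \<Rightarrow>
   ('k, 'f::banach) inner_structure \<Rightarrow> ('f \<Rightarrow> 'e) \<Rightarrow> ('x, 'e, 'f) node \<Rightarrow> bool" where
  "dirac_node E X F \<psi> S \<longleftrightarrow>
     unitary_op F E \<psi> \<and>
     linear_op (prod_space X E) (prod_space X F) (ndom S) (\<lambda>w. (AB S w, CD S w)) \<and>
     maximal_dissipative (prod_space X E) (ndom S) (\<lambda>w. (AB S w, - \<psi> (CD S w))) \<and>
     (\<exists>\<beta>. 0 < rc_re \<beta> \<and> cayley_injective E \<psi> \<beta> S)"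

definition bounded_node ::
  "'x set \<Rightarrow> ('x \<Rightarrow> 'x) \<Rightarrow> ('e \<Rightarrow> 'x) \<Rightarrow> ('x \<Rightarrow> 'f) \<Rightarrow> ('e \<Rightarrow> 'f) \<Rightarrow>
   ('x::ab_group_add, 'e, 'f::ab_group_add) node" where
  "bounded_node domA A B C D =
     \<lparr> ndom = domA \<times> UNIV,
       AB = (\<lambda>(x, e). A x + B e),
       CD = (\<lambda>(x, e). C x + D e) \<rparr>"

definition cayley_map ::
  "('k::rc_scalar, 'e::banach) inner_structure \<Rightarrow> ('f \<Rightarrow> 'e) \<Rightarrow> 'k \<Rightarrow>
   ('x::banach, 'e, 'f) node \<Rightarrow> 'x \<times> 'e \<Rightarrow> 'x \<times> 'e" where
  "cayley_map E \<psi> \<beta> S =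
     (\<lambda>(x, e). (sqrt (2 * rc_re \<beta>) *\<^sub>R x, scal E \<beta> e + \<psi> (CD S (x, e))))"

definition cayley_transform ::
  "('k::rc_scalar, 'e::banach) inner_structure \<Rightarrow> ('f \<Rightarrow> 'e) \<Rightarrow> 'k \<Rightarrow>
   ('x::banach, 'e, 'f) node \<Rightarrow> ('x, 'e, 'e) node" where
  "cayley_transform E \<psi> \<beta> S =
     (let M = cayley_map E \<psi> \<beta> S; Minv = inv_into (ndom S) M in
      \<lparr> ndom = M ` ndom S,
        AB = (\<lambda>z. sqrt (2 * rc_re \<beta>) *\<^sub>R AB S (Minv z)),
        CD = (\<lambda>z. scal E (rc_conj \<beta>) (snd (Minv z)) - \<psi> (CD S (Minv z))) \<rparr>)"

section \<open>Function spaces on the half-line\<close>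

text \<open>
  Functions on the half-line are total functions on the reals whose values at negative times
  are irrelevant. Elements of \<open>L2\<close> and \<open>L2_loc\<close> are represented by
  functions; the corresponding equality is \<open>ae_eq\<close>, and \<open>ae_class\<close> is the
  actual element of the quotient. Measurability in the sense of \<open>measurable_on\<close>
  is strong (Bochner) measurability, so that the value spaces need not be separable.
\<close>

definition L2 :: "(real \<Rightarrow> 'a::banach) set" where
  "L2 = {u. u measurable_on {0..} \<and> (\<lambda>t. (norm (u t))\<^sup>2) integrable_on {0..}}"

definition L2_norm :: "(real \<Rightarrow> 'a::banach) \<Rightarrow> real" where
  "L2_norm u = sqrt (integral {0..} (\<lambda>t. (norm (u t))\<^sup>2))"

definition L2_loc :: "(real \<Rightarrow> 'a::banach) set" where
  "L2_loc = {u. u measurable_on {0..} \<and> (\<forall>\<tau>\<ge>0. (\<lambda>t. (norm (u t))\<^sup>2) integrable_on {0..\<tau>})}"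

definition ae_eq :: "(real \<Rightarrow> 'a) \<Rightarrow> (real \<Rightarrow> 'a) \<Rightarrow> bool" where
  "ae_eq u v \<longleftrightarrow> (AE t in lebesgue_on {0..}. u t = v t)"

definition ae_class :: "(real \<Rightarrow> 'a) \<Rightarrow> (real \<Rightarrow> 'a) set" where
  "ae_class u = {v. ae_eq u v}"

definition tendsto_L2_loc :: "(real \<Rightarrow> real \<Rightarrow> 'a::banach) \<Rightarrow> (real \<Rightarrow> 'a) \<Rightarrow> bool" where
  "tendsto_L2_loc w v \<longleftrightarrow>
     (\<forall>\<tau>\<ge>0. ((\<lambda>t. integral {0..\<tau>} (\<lambda>s. (norm (w t s - v s))\<^sup>2)) \<longlongrightarrow> 0) at_top)"

text \<open>
  Membership in \<open>H1_loc\<close> is membership of the continuous representative. For a locally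
  square integrable integrand the gauge integral coincides with the Bochner integral.
\<close>

definition H1_loc :: "(real \<Rightarrow> 'a::banach) set" where
  "H1_loc = {u. \<exists>g\<in>L2_loc. \<forall>t\<ge>0. (g has_integral (u t - u 0)) {0..t}}"

definition C1_fun :: "(real \<Rightarrow> 'a::real_normed_vector) set" where
  "C1_fun = {u. \<exists>u'. continuous_on {0..} u' \<and>
                  (\<forall>t\<ge>0. (u has_vector_derivative u' t) (at t within {0..}))}"

definition C2_fun :: "(real \<Rightarrow> 'a::real_normed_vector) set" where
  "C2_fun = {u. \<exists>u'\<in>C1_fun. \<forall>t\<ge>0. (u has_vector_derivative u' t) (at t within {0..})}"

definition trunc :: "real \<Rightarrow> real \<Rightarrow> (real \<Rightarrow> 'a::real_vector) \<Rightarrow> real \<Rightarrow> 'a" where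
  "trunc r t u = (\<lambda>s. indicator {r..t} s *\<^sub>R u s)"

section \<open>Classical solutions\<close>

definition admissible_PG ::
  "('k::rc_scalar, 'x::banach) inner_structure \<Rightarrow> (real \<Rightarrow> 'x \<Rightarrow> 'x) \<Rightarrow> (real \<Rightarrow> 'x \<Rightarrow> 'x) \<Rightarrow> bool" where
  "admissible_PG X P G \<longleftrightarrow>
     (\<forall>t\<ge>0. positive_op X (P t) \<and> bij (P t) \<and> bounded_op X X (inv (P t)) \<and> bounded_op X X (G t)) \<and>
     (\<forall>z. (\<lambda>t. P t z) \<in> C2_fun \<and> (\<lambda>t. inv (P t) z) \<in> C1_fun \<and> (\<lambda>t. G t z) \<in> C1_fun)"

definition classical_solution ::
  "('x::banach, 'e::banach, 'f::banach) node \<Rightarrow> (real \<Rightarrow> 'x \<Rightarrow> 'x) \<Rightarrow> (real \<Rightarrow> 'x \<Rightarrow> 'x) \<Rightarrow>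
   (real \<Rightarrow> 'e) \<Rightarrow> (real \<Rightarrow> 'x) \<Rightarrow> (real \<Rightarrow> 'f) \<Rightarrow> bool" where
  "classical_solution S P G e x f \<longleftrightarrow>
     e \<in> H1_loc \<and> x \<in> C1_fun \<and> f \<in> H1_loc \<and>
     (\<forall>t\<ge>0. (P t (x t), e t) \<in> ndom S \<and>
        (x has_vector_derivative (AB S (P t (x t), e t) + G t (inv (P t) (P t (x t)))))
          (at t within {0..}) \<and>
        f t = CD S (P t (x t), e t))"

definition unique_classical_solution ::
  "('x::banach, 'e::banach, 'f::banach) node \<Rightarrow> (real \<Rightarrow> 'x \<Rightarrow> 'x) \<Rightarrow> (real \<Rightarrow> 'x \<Rightarrow> 'x) \<Rightarrow>
   'x \<Rightarrow> (real \<Rightarrow> 'e) \<Rightarrow> (real \<Rightarrow> 'x) \<Rightarrow> (real \<Rightarrow> 'f) \<Rightarrow> bool" where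
  "unique_classical_solution S P G x0 e x f \<longleftrightarrow>
     classical_solution S P G e x f \<and> x 0 = x0 \<and>
     (\<forall>x' f'. classical_solution S P G e x' f' \<and> x' 0 = x0 \<longrightarrow>
        (\<forall>t\<ge>0. x' t = x t \<and> f' t = f t))"

definition V_cross ::
  "('k::rc_scalar, 'e::banach) inner_structure \<Rightarrow> ('f \<Rightarrow> 'e) \<Rightarrow> 'k \<Rightarrow> ('x::banach, 'e, 'f) node \<Rightarrow>
   (real \<Rightarrow> 'x \<Rightarrow> 'x) \<Rightarrow> ('x \<times> (real \<Rightarrow> 'e)) set" where
  "V_cross E \<psi> \<beta> S P =
     {(x0, u). u \<in> H1_loc \<and> (P 0 x0, u 0) \<in> ndom (cayley_transform E \<psi> \<beta> S)}"

section \<open>Time-varying well-posed systems\<close>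

record ('u, 'x, 'y) tv_system =
  evol :: "real \<Rightarrow> real \<Rightarrow> 'x \<Rightarrow> 'x"
  ctrl :: "real \<Rightarrow> real \<Rightarrow> (real \<Rightarrow> 'u) \<Rightarrow> 'x"
  obsv :: "real \<Rightarrow> real \<Rightarrow> 'x \<Rightarrow> real \<Rightarrow> 'y"
  inout :: "real \<Rightarrow> real \<Rightarrow> (real \<Rightarrow> 'u) \<Rightarrow> real \<Rightarrow> 'y"

text \<open>
  Linearity of operators into or out of \<open>L2\<close>, acting on representatives. Together with
  boundedness it implies that almost everywhere equal functions have equal images.
\<close>

definition linear_from_L2 ::
  "('k::rc_scalar, 'u::banach) inner_structure \<Rightarrow> ('k, 'x::banach) inner_structure \<Rightarrow>
   ((real \<Rightarrow> 'u) \<Rightarrow> 'x) \<Rightarrow> bool" where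
  "linear_from_L2 U X \<Phi> \<longleftrightarrow>
     (\<forall>u\<in>L2. \<forall>v\<in>L2. \<Phi> (\<lambda>t. u t + v t) = \<Phi> u + \<Phi> v) \<and>
     (\<forall>c. \<forall>u\<in>L2. \<Phi> (\<lambda>t. scal U c (u t)) = scal X c (\<Phi> u))"

definition linear_to_L2 ::
  "('k::rc_scalar, 'x::banach) inner_structure \<Rightarrow> ('k, 'y::banach) inner_structure \<Rightarrow>
   ('x \<Rightarrow> real \<Rightarrow> 'y) \<Rightarrow> bool" where
  "linear_to_L2 X Y \<Psi> \<longleftrightarrow>
     (\<forall>x. \<Psi> x \<in> L2) \<and>
     (\<forall>x z. ae_eq (\<Psi> (x + z)) (\<lambda>t. \<Psi> x t + \<Psi> z t)) \<and>
     (\<forall>c x. ae_eq (\<Psi> (scal X c x)) (\<lambda>t. scal Y c (\<Psi> x t)))"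

definition linear_L2_L2 ::
  "('k::rc_scalar, 'u::banach) inner_structure \<Rightarrow> ('k, 'y::banach) inner_structure \<Rightarrow>
   ((real \<Rightarrow> 'u) \<Rightarrow> real \<Rightarrow> 'y) \<Rightarrow> bool" where
  "linear_L2_L2 U Y \<F> \<longleftrightarrow>
     (\<forall>u\<in>L2. \<F> u \<in> L2) \<and>
     (\<forall>u\<in>L2. \<forall>v\<in>L2. ae_eq (\<F> (\<lambda>t. u t + v t)) (\<lambda>t. \<F> u t + \<F> v t)) \<and>
     (\<forall>c. \<forall>u\<in>L2. ae_eq (\<F> (\<lambda>t. scal U c (u t))) (\<lambda>t. scal Y c (\<F> u t)))"

text \<open>
  Boundedness of the individual operators is contained in the local uniform bound.
\<close>

definition tv_well_posed ::
  "('k::rc_scalar, 'u::banach) inner_structure \<Rightarrow> ('k, 'x::banach) inner_structure \<Rightarrow>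
   ('k, 'y::banach) inner_structure \<Rightarrow> ('u, 'x, 'y) tv_system \<Rightarrow> bool" where
  "tv_well_posed U X Y \<Sigma> \<longleftrightarrow>
     (\<forall>r\<ge>0. \<forall>t\<ge>r.
        bounded_op X X (evol \<Sigma> t r) \<and> linear_from_L2 U X (ctrl \<Sigma> t r) \<and>
        linear_to_L2 X Y (obsv \<Sigma> t r) \<and> linear_L2_L2 U Y (inout \<Sigma> t r)) \<and>
     (\<forall>t\<ge>0. evol \<Sigma> t t = id) \<and>
     (\<forall>r\<ge>0. \<forall>s\<ge>r. \<forall>t\<ge>s. evol \<Sigma> t s \<circ> evol \<Sigma> s r = evol \<Sigma> t r) \<and>
     (\<forall>x. continuous_on {(t, r). 0 \<le> r \<and> r \<le> t} (\<lambda>(t, r). evol \<Sigma> t r x)) \<and>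
     (\<forall>r\<ge>0. \<forall>t\<ge>r.
        (\<forall>u\<in>L2. ctrl \<Sigma> t r u = ctrl \<Sigma> t r (trunc r t u)) \<and>
        (\<forall>x. ae_eq (obsv \<Sigma> t r x) (trunc r t (obsv \<Sigma> t r x))) \<and>
        (\<forall>u\<in>L2. ae_eq (inout \<Sigma> t r u) (trunc r t (inout \<Sigma> t r u)) \<and>
                ae_eq (inout \<Sigma> t r u) (inout \<Sigma> t r (trunc r t u)))) \<and>
     (\<forall>\<tau>\<ge>0. \<exists>M. \<forall>r\<ge>0. \<forall>t\<ge>r. t \<le> \<tau> \<longrightarrow>
        (\<forall>x. norm (evol \<Sigma> t r x) \<le> M * norm x \<and>
             L2_norm (obsv \<Sigma> t r x) \<le> M * norm x) \<and>
        (\<forall>u\<in>L2. norm (ctrl \<Sigma> t r u) \<le> M * L2_norm u \<and>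
                L2_norm (inout \<Sigma> t r u) \<le> M * L2_norm u)) \<and>
     (\<forall>r\<ge>0. \<forall>s\<ge>r. \<forall>t\<ge>s.
        (\<forall>u\<in>L2. ctrl \<Sigma> t r u = ctrl \<Sigma> t s u + evol \<Sigma> t s (ctrl \<Sigma> s r u)) \<and>
        (\<forall>x. ae_eq (obsv \<Sigma> t r x)
               (\<lambda>\<theta>. obsv \<Sigma> t s (evol \<Sigma> s r x) \<theta> + obsv \<Sigma> s r x \<theta>)) \<and>
        (\<forall>u\<in>L2. ae_eq (inout \<Sigma> t r u)
               (\<lambda>\<theta>. inout \<Sigma> t s u \<theta> + inout \<Sigma> s r u \<theta> + obsv \<Sigma> t s (ctrl \<Sigma> s r u) \<theta>)))"

definition mild_solution ::
  "('u::banach, 'x::banach, 'y::banach) tv_system \<Rightarrow> 'x \<Rightarrow>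
   (real \<Rightarrow> 'u) \<Rightarrow> (real \<Rightarrow> 'x) \<Rightarrow> (real \<Rightarrow> 'y) \<Rightarrow> bool" where
  "mild_solution \<Sigma> x0 u x y \<longleftrightarrow>
     u \<in> L2_loc \<and> continuous_on {0..} x \<and> y \<in> L2_loc \<and>
     (\<forall>t\<ge>0. x t = evol \<Sigma> t 0 x0 + ctrl \<Sigma> t 0 (trunc 0 t u) \<and>
        ae_eq (trunc 0 t y) (\<lambda>s. obsv \<Sigma> t 0 x0 s + inout \<Sigma> t 0 (trunc 0 t u) s))"

text \<open>
  \<open>\<Sigma>\<close> is a well-posed system belonging to the scattering representation for the
  data \<open>\<beta>\<close>, \<open>P\<close>, \<open>G\<close>. Uniqueness of the mild solution
  is immediate from its defining formulas.
\<close>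

definition scattering_system ::
  "('k::rc_scalar, 'e::banach) inner_structure \<Rightarrow> ('k, 'x::banach) inner_structure \<Rightarrow>
   ('f \<Rightarrow> 'e) \<Rightarrow> 'k \<Rightarrow> ('x, 'e, 'f) node \<Rightarrow> (real \<Rightarrow> 'x \<Rightarrow> 'x) \<Rightarrow> (real \<Rightarrow> 'x \<Rightarrow> 'x) \<Rightarrow>
   ('e, 'x, 'e) tv_system \<Rightarrow> bool" where
  "scattering_system E X \<psi> \<beta> S P G \<Sigma> \<longleftrightarrow>
     tv_well_posed E X E \<Sigma> \<and>
     (\<forall>(x0, u) \<in> V_cross E \<psi> \<beta> S P. \<exists>x y.
        unique_classical_solution (cayley_transform E \<psi> \<beta> S) P G x0 u x y \<and>
        mild_solution \<Sigma> x0 u x y)"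

text \<open>
  \<open>\<Sigma> \<beta> P G\<close> is the well-posed system belonging to the scattering
  representation, for all data for which it is known to exist when \<open>S\<close> is a Dirac
  node; the space \<open>V_limit\<close> below is defined through its operators.
\<close>

definition scattering_family ::
  "('k::rc_scalar, 'e::banach) inner_structure \<Rightarrow> ('k, 'x::banach) inner_structure \<Rightarrow>
   ('f \<Rightarrow> 'e) \<Rightarrow> ('x, 'e, 'f) node \<Rightarrow>
   ('k \<Rightarrow> (real \<Rightarrow> 'x \<Rightarrow> 'x) \<Rightarrow> (real \<Rightarrow> 'x \<Rightarrow> 'x) \<Rightarrow> ('e, 'x, 'e) tv_system) \<Rightarrow> bool" where
  "scattering_family E X \<psi> S \<Sigma> \<longleftrightarrow>
     (\<forall>\<beta> P G. 0 < rc_re \<beta> \<and> cayley_injective E \<psi> \<beta> S \<and> admissible_PG X P G \<longrightarrow>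
        scattering_system E X \<psi> \<beta> S P G (\<Sigma> \<beta> P G))"

text \<open>
  The second components of \<open>V_limit\<close> are elements of the quotient space
  \<open>L2_loc\<close>; \<open>to_L2_loc\<close> embeds pairs with a function as second component.
\<close>

definition to_L2_loc :: "'x \<times> (real \<Rightarrow> 'e) \<Rightarrow> 'x \<times> (real \<Rightarrow> 'e) set" where
  "to_L2_loc = (\<lambda>(x, u). (x, ae_class u))"

definition V_limit ::
  "('k::rc_scalar, 'e::banach) inner_structure \<Rightarrow> ('f \<Rightarrow> 'e) \<Rightarrow> 'k \<Rightarrow> ('x::banach, 'e, 'f) node \<Rightarrow>
   (real \<Rightarrow> 'x \<Rightarrow> 'x) \<Rightarrow> ('e, 'x, 'e) tv_system \<Rightarrow> ('x \<times> (real \<Rightarrow> 'e) set) set" where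
  "V_limit E \<psi> \<beta> S P \<Sigma> =
     {to_L2_loc (sqrt (2 * rc_re \<beta>) *\<^sub>R x0, v) | x0 u v.
        (x0, u) \<in> V_cross E \<psi> \<beta> S P \<and> v \<in> L2_loc \<and>
        tendsto_L2_loc (\<lambda>t s. obsv \<Sigma> t 0 x0 s + u s + inout \<Sigma> t 0 (trunc 0 t u) s) v}"

end

theory Submission
  imports Defs
begin

text \<open>
  Dissipativity of the node makes \<open>\<beta> I + D\<close> coercive, hence boundedly invertible. Eliminating \<open>e\<close> from
  the range condition shows that \<open>A - B (l I + D)\<^sup>-\<^sup>1 C\<close> is maximal dissipative; \<open>A\<close> is dissipative and a
  bounded perturbation of it, so \<open>A\<close> is maximal dissipative and generates a contraction semigroup.

  The Cayley transform of a node with bounded \<open>B\<close>, \<open>C\<close>, \<open>D\<close> hides the bounded feedback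
  \<open>- B (\<beta> I + D)\<^sup>-\<^sup>1 C P x\<close> in the state equation. This term has the form of a multiplier \<open>G\<close>, so it can
  be compensated by applying the known solvability of the scattering representation to
  \<open>G + B (\<beta> I + D)\<^sup>-\<^sup>1 C P\<close> in place of \<open>G\<close>. Thus \<open>e\<close> can be prescribed instead of \<open>u\<close>, and since the
  limit defining \<open>V_limit\<close> is \<open>u + y = sqrt (2 Re \<beta>) e\<close>, every element of \<open>V_cross\<close> is attained.
\<close>

section \<open>Dissipative operators and their resolvents\<close>

text \<open>The node supplies surjectivity for \<open>A - B (l I + D)^-1 C\<close> at a single
  \<open>l\<close>, and the norm of the perturbation may exceed this \<open>l\<close>. Surjectivity
  is therefore first carried to all positive parameters, and the perturbation is removed at a
  parameter above its norm.

  The obstacle to prescribing \<open>e\<close> is that the corresponding input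
  \<open>u = (\<beta> e + C P x + D e) / \<gamma>\<close>,
  \<open>\<gamma> = sqrt (2 Re \<beta>)\<close>, contains the unknown state. With
  \<open>R = (\<beta> I + D)^-1\<close>, an input \<open>u\<close> produces the effort
  \<open>R (\<gamma> u) - R C P x\<close>. Choosing \<open>\<gamma> u = (\<beta> I + D) e\<close>
  gives \<open>e - R C P x\<close>, so the state equation is wrong by exactly
  \<open>- B R C P x\<close>, which the modified multiplier restores. The modified data are again
  admissible with the same \<open>P\<close> and \<open>\<beta>\<close>, because
  \<open>P(.) z\<close> is in particular C1. The known solvability is thus used twice: at the
  modified multiplier to solve for given \<open>e\<close>, and at \<open>G\<close> itself to
  identify the limit space. Every solution with effort \<open>e\<close> is sent to a solution of the
  modified scattering problem with this same \<open>u\<close>, so uniqueness is inherited as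
  well.\<close>

locale dissipative_on =
  fixes D :: "'a::banach set" and A :: "'a \<Rightarrow> 'a"
  assumes subspace_D: "subspace D"
    and A_add: "\<lbrakk>x \<in> D; y \<in> D\<rbrakk> \<Longrightarrow> A (x + y) = A x + A y"
    and A_scaleR: "x \<in> D \<Longrightarrow> A (r *\<^sub>R x) = r *\<^sub>R A x"
    and norm_le_resolvent: "\<lbrakk>x \<in> D; 0 < h\<rbrakk> \<Longrightarrow> norm x \<le> norm (x - h *\<^sub>R A x)"
begin

lemma A_diff: "\<lbrakk>x \<in> D; y \<in> D\<rbrakk> \<Longrightarrow> A (x - y) = A x - A y"
  using A_add[of x "(-1) *\<^sub>R y"] A_scaleR[of y "-1"] subspace_scale[OF subspace_D, of y "-1"] by simp

lemma scaled_norm_le: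
  assumes "x \<in> D" "0 < l" shows "l * norm x \<le> norm (l *\<^sub>R x - A x)"
proof -
  have "l * norm x \<le> l * norm (x - (1 / l) *\<^sub>R A x)"
    using norm_le_resolvent[of x "1 / l"] assms by simp
  also have "\<dots> = norm (l *\<^sub>R (x - (1 / l) *\<^sub>R A x))" using assms by simp
  also have "l *\<^sub>R (x - (1 / l) *\<^sub>R A x) = l *\<^sub>R x - A x" using assms by (simp add: algebra_simps)
  finally show ?thesis .
qed

text \<open>With \<open>R = (l I - A)^-1\<close> the equation reads \<open>x = R (y + K x)\<close>.
  Dissipativity makes \<open>R\<close> Lipschitz with constant \<open>1 / l\<close>, so the
  right-hand side is a contraction with factor \<open>k / l < 1\<close>.\<close>

lemma onto_bounded_perturbation:
  assumes l: "0 < l" and onto: "(\<lambda>x. l *\<^sub>R x - A x) ` D = UNIV"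
    and K: "bounded_linear K" "\<And>x. norm (K x) \<le> k * norm x" "0 \<le> k" "k < l"
  shows "(\<lambda>x. l *\<^sub>R x - A x - K x) ` D = UNIV"
proof -
  interpret K: bounded_linear K by (rule K)
  define R where "R = inv_into D (\<lambda>x. l *\<^sub>R x - A x)"
  have R: "R y \<in> D" "l *\<^sub>R R y - A (R y) = y" for y
    using inv_into_into[of y "\<lambda>x. l *\<^sub>R x - A x" D] f_inv_into_f[of y "\<lambda>x. l *\<^sub>R x - A x" D] onto
    by (auto simp: R_def)
  have R_lip: "l * norm (R y - R z) \<le> norm (y - z)" for y z
  proof -
    have "l *\<^sub>R (R y - R z) - A (R y - R z) = y - z"
      using R[of y] R[of z] by (simp add: A_diff algebra_simps)
    then show ?thesis
      using scaled_norm_le[of "R y - R z" l] l R(1) by (simp add: subspace_diff[OF subspace_D])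
  qed
  have "\<exists>x\<in>D. y = l *\<^sub>R x - A x - K x" for y
  proof -
    have "dist (R (y + K u)) (R (y + K v)) \<le> (k / l) * dist u v" for u v
    proof -
      have "l * norm (R (y + K u) - R (y + K v)) \<le> k * norm (u - v)"
        using R_lip[of "y + K u" "y + K v"] K(2)[of "u - v"] by (simp add: K.diff)
      then show ?thesis using l by (simp add: dist_norm field_simps)
    qed
    then obtain x where "R (y + K x) = x"
      using banach_fix_type[of "k / l" "\<lambda>x. R (y + K x)"] K(3,4) l by auto
    then show ?thesis using R[of "y + K x"] by (auto intro!: bexI[of _ x] simp: algebra_simps)
  qed
  then have "y \<in> (\<lambda>x. l *\<^sub>R x - A x - K x) ` D" for y unfolding image_iff .
  then show ?thesis by (intro equalityI subsetI UNIV_I)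
qed

text \<open>Changing the parameter \<open>m\<close> to \<open>\<nu>\<close> is a perturbation by
  \<open>(m - \<nu>) I\<close>, which is small enough exactly when \<open>0 < \<nu> < 2 m\<close>.
  Growth by \<open>3 / 2\<close>, a factor strictly between 1 and 2, passes every bound; one last
  step then goes down to \<open>\<mu>\<close>.\<close>

lemma onto_all:
  assumes l: "0 < l" "(\<lambda>x. l *\<^sub>R x - A x) ` D = UNIV" and "0 < \<mu>"
  shows "(\<lambda>x. \<mu> *\<^sub>R x - A x) ` D = UNIV"
proof -
  have step: "(\<lambda>x. \<nu> *\<^sub>R x - A x) ` D = UNIV"
    if "0 < m" "(\<lambda>x. m *\<^sub>R x - A x) ` D = UNIV" "0 < \<nu>" "\<nu> < 2 * m" for m \<nu>
  proof -
    have "(\<lambda>x. m *\<^sub>R x - A x - (m - \<nu>) *\<^sub>R x) ` D = UNIV"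
      using that by (intro onto_bounded_perturbation[where k = "\<bar>m - \<nu>\<bar>"] bounded_linear_scaleR_right)
        auto
    then show ?thesis by (simp add: algebra_simps)
  qed
  have iter: "(\<lambda>x. (l * (3 / 2) ^ n) *\<^sub>R x - A x) ` D = UNIV" for n
  proof (induction n)
    case (Suc n)
    then show ?case using l by (intro step[OF _ Suc]) auto
  qed (use l in simp)
  obtain n where "\<mu> / l < (3 / 2) ^ n"
    using real_arch_pow[of "3 / 2" "\<mu> / l"] by auto
  then have "\<mu> < l * (3 / 2) ^ n" using l by (simp add: field_simps)
  moreover have "0 < l * (3 / 2) ^ n" using l by simp
  ultimately show ?thesis using \<open>0 < \<mu>\<close> by (intro step[OF _ iter[of n]]) linarith+
qed

end

section \<open>Resolvents of maximal dissipative operators\<close>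

locale m_dissipative = dissipative_on +
  assumes onto: "0 < h \<Longrightarrow> \<exists>x\<in>D. x - h *\<^sub>R A x = y"

lemma (in dissipative_on) m_dissipativeI:
  assumes "0 < l" "(\<lambda>x. l *\<^sub>R x - A x) ` D = UNIV"
  shows "m_dissipative D A"
proof
  fix h :: real and y assume h: "0 < h"
  then have "(\<lambda>x. (1 / h) *\<^sub>R x - A x) ` D = UNIV"
    by (intro onto_all[OF assms]) simp
  then obtain x where x: "x \<in> D" "(1 / h) *\<^sub>R y = (1 / h) *\<^sub>R x - A x" by blast
  have "x - h *\<^sub>R A x = h *\<^sub>R ((1 / h) *\<^sub>R x - A x)" using h by (simp add: algebra_simps)
  also have "\<dots> = y" unfolding x(2)[symmetric] using h by simp
  finally show "\<exists>x\<in>D. x - h *\<^sub>R A x = y" using x by blast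
qed

context m_dissipative
begin

text \<open>The resolvent \<open>(I - h A)^-1\<close>, that is, one backward Euler step of length
  \<open>h\<close> for \<open>x' = A x\<close>.\<close>

definition J :: "real \<Rightarrow> 'a \<Rightarrow> 'a" where
  "J h y = (SOME x. x \<in> D \<and> x - h *\<^sub>R A x = y)"

lemma
  assumes "0 < h"
  shows J_in: "J h y \<in> D" and J_eq: "J h y - h *\<^sub>R A (J h y) = y"
  using someI_ex[of "\<lambda>x. x \<in> D \<and> x - h *\<^sub>R A x = y"] onto[OF assms, of y]
  by (auto simp: J_def)

lemma J_unique:
  assumes "0 < h" "x \<in> D" "x - h *\<^sub>R A x = y" shows "J h y = x"
proof -
  have "J h y - x \<in> D" using J_in assms subspace_diff[OF subspace_D] by blast
  moreover have "(J h y - x) - h *\<^sub>R A (J h y - x) = (J h y - h *\<^sub>R A (J h y)) - (x - h *\<^sub>R A x)"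
    using J_in assms(1,2) by (simp add: A_diff scaleR_diff_right)
  then have "(J h y - x) - h *\<^sub>R A (J h y - x) = 0" using J_eq assms by simp
  ultimately have "norm (J h y - x) \<le> 0" using norm_le_resolvent[of "J h y - x" h] assms by simp
  then show ?thesis by simp
qed

lemma norm_J_le: "0 < h \<Longrightarrow> norm (J h y) \<le> norm y"
  using norm_le_resolvent[of "J h y" h] J_in J_eq by auto

text \<open>Two instances matter: \<open>L\<close> another resolvent, and \<open>L\<close> a scalar
  multiplication, through which the semigroup becomes linear over the scalar field and not only over
  the reals.\<close>

lemma J_comm:
  assumes "0 < h" "bounded_linear L" "\<And>x. x \<in> D \<Longrightarrow> L x \<in> D \<and> A (L x) = L (A x)"
  shows "J h (L y) = L (J h y)"
proof -
  interpret L: bounded_linear L by fact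
  show ?thesis
    using J_eq[of h y, THEN arg_cong, of L] J_in[of h y] assms
    by (intro J_unique) (auto simp: L.diff L.scaleR)
qed

lemma J_bounded_linear:
  assumes h: "0 < h" shows "bounded_linear (J h)"
proof (rule bounded_linear_intro[where K = 1])
  fix x y and r :: real
  have "(J h x + J h y) - h *\<^sub>R A (J h x + J h y) = (J h x - h *\<^sub>R A (J h x)) + (J h y - h *\<^sub>R A (J h y))"
    using J_in[OF h] by (simp add: A_add algebra_simps)
  then show "J h (x + y) = J h x + J h y"
    using J_in[OF h] J_eq[OF h] subspace_add[OF subspace_D] by (intro J_unique[OF h]) auto
  have "r *\<^sub>R J h x - h *\<^sub>R A (r *\<^sub>R J h x) = r *\<^sub>R (J h x - h *\<^sub>R A (J h x))"
    using J_in[OF h] by (simp add: A_scaleR algebra_simps)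
  then show "J h (r *\<^sub>R x) = r *\<^sub>R J h x"
    using J_in[OF h] J_eq[OF h] subspace_scale[OF subspace_D] by (intro J_unique[OF h]) auto
  show "norm (J h x) \<le> norm x * 1" using norm_J_le[OF h] by simp
qed

lemma J_A:
  assumes h: "0 < h" and x: "x \<in> D" shows "J h (A x) = A (J h x)"
proof -
  have e: "A (J h x) = (1 / h) *\<^sub>R (J h x - x)"
  proof -
    have "J h x - x = h *\<^sub>R A (J h x)" using J_eq[OF h, of x] by (simp add: algebra_simps)
    then show ?thesis using h by simp
  qed
  have "A (J h x) \<in> D"
    unfolding e using J_in[OF h] x subspace_diff[OF subspace_D] subspace_scale[OF subspace_D] by blast
  moreover have "A (J h x) - h *\<^sub>R A (A (J h x)) = A x"
  proof -
    have "A (J h x - h *\<^sub>R A (J h x)) = A x" using J_eq[OF h, of x] by simp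
    then show ?thesis
      using J_in[OF h] \<open>A (J h x) \<in> D\<close> subspace_scale[OF subspace_D] by (simp add: A_diff A_scaleR)
  qed
  ultimately show ?thesis by (rule J_unique[OF h])
qed

lemma J_J_comm:
  assumes "0 < a" "0 < b" shows "J a (J b x) = J b (J a x)"
  using assms by (intro J_comm J_bounded_linear) (auto simp: J_in J_A)

lemma J_diff: "\<lbrakk>0 < h; x \<in> D\<rbrakk> \<Longrightarrow> J h x - x = h *\<^sub>R J h (A x)"
  using J_eq[of h x] by (simp add: J_A algebra_simps)

lemma norm_J_diff_le: "\<lbrakk>0 < h; x \<in> D\<rbrakk> \<Longrightarrow> norm (J h x - x) \<le> h * norm (A x)"
  using norm_J_le[of h "A x"] by (simp add: J_diff)

text \<open>A pair \<open>(x, z)\<close> lies on the graph iff \<open>x = J 1 (x - z)\<close>, an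
  equation between continuous functions of the pair.\<close>

lemma closed_A: "closed ((\<lambda>x. (x, A x)) ` D)"
proof -
  have "(\<lambda>x. (x, A x)) ` D = {p. fst p = J 1 (fst p - snd p)}"
  proof (intro set_eqI iffI)
    fix p assume "p \<in> (\<lambda>x. (x, A x)) ` D"
    then show "p \<in> {p. fst p = J 1 (fst p - snd p)}" by (auto intro!: J_unique[symmetric])
  next
    fix p :: "'a \<times> 'a" assume p: "p \<in> {p. fst p = J 1 (fst p - snd p)}"
    define y where "y = fst p - snd p"
    have "J 1 y = fst p" using p by (simp add: y_def)
    then have "fst p \<in> D" "A (fst p) = snd p"
      using J_in[of 1 y] J_eq[of 1 y] by (auto simp: y_def)
    then show "p \<in> (\<lambda>x. (x, A x)) ` D"
      by (intro image_eqI[of p _ "fst p"]) (simp_all add: prod_eq_iff)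
  qed
  moreover have "continuous_on UNIV (\<lambda>p. J 1 (fst p - snd p))"
    by (rule bounded_linear.continuous_on[OF J_bounded_linear[of 1]]) (auto intro!: continuous_intros)
  then have "closed {p. fst p = J 1 (fst p - snd p)}"
    by (rule closed_Collect_eq[rotated]) (rule continuous_on_fst[OF continuous_on_id])
  ultimately show ?thesis by simp
qed

text \<open>The product \<open>(I - a A) (I - b A)\<close> differs from \<open>I - (a + b) A\<close>
  by \<open>a b A A\<close>. Hence the difference of the two resolvent expressions is
  \<open>a b J (a + b) (A (A z))\<close>, and \<open>A (A z)\<close> is a contraction applied to
  \<open>A (A x)\<close>.\<close>

lemma norm_J_J_diff_le:
  assumes a: "0 < a" and b: "0 < b" and x: "x \<in> D" "A x \<in> D"
  shows "norm (J a (J b x) - J (a + b) x) \<le> a * b * norm (A (A x))"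
proof -
  define z where "z = J b (J a x)"
  interpret J: bounded_linear "J (a + b)" using a b by (intro J_bounded_linear) simp
  have Az: "A z = J b (J a (A x))" and AAz: "A (A z) = J b (J a (A (A x)))"
    using a b x by (simp_all add: z_def J_in flip: J_A)
  have zD: "z \<in> D" "A z \<in> D"
    unfolding Az using J_in[OF b] by (simp_all add: z_def)
  have 1: "z - b *\<^sub>R A z = J a x" using b by (simp add: z_def J_eq)
  have "A (z - b *\<^sub>R A z) = A z - b *\<^sub>R A (A z)"
    using zD subspace_scale[OF subspace_D] by (simp add: A_diff A_scaleR)
  then have "z - b *\<^sub>R A z - a *\<^sub>R (A z - b *\<^sub>R A (A z)) = x" using J_eq[OF a, of x] 1 by simp
  then have "z - (a + b) *\<^sub>R A z = x - (a * b) *\<^sub>R A (A z)" by (simp add: algebra_simps)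
  then have "J (a + b) (x - (a * b) *\<^sub>R A (A z)) = z"
    using a b zD by (intro J_unique) auto
  then have "z - J (a + b) x = - ((a * b) *\<^sub>R J (a + b) (A (A z)))"
    by (simp add: J.diff J.scaleR algebra_simps)
  then have "norm (z - J (a + b) x) = a * b * norm (J (a + b) (A (A z)))" using a b by simp
  also have "norm (J (a + b) (A (A z))) \<le> norm (A (A x))"
    unfolding AAz using norm_J_le[OF a, of "A (A x)"] norm_J_le[OF b, of "J a (A (A x))"]
      norm_J_le[of "a + b" "J b (J a (A (A x)))"] a b by linarith
  then have "a * b * norm (J (a + b) (A (A z))) \<le> a * b * norm (A (A x))"
    using a b by (intro mult_left_mono) auto
  finally show ?thesis using J_J_comm[OF a b, of x] by (simp add: z_def)
qed

end

section \<open>Powers of commuting contractions, and limits determined on dense sets\<close>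

lemma norm_funpow_le:
  fixes f :: "'a::real_normed_vector \<Rightarrow> 'a"
  assumes "\<And>x. norm (f x) \<le> norm x"
  shows "norm ((f ^^ n) x) \<le> norm x"
proof (induction n)
  case (Suc n)
  then show ?case using assms[of "(f ^^ n) x"] by simp
qed simp

lemma funpow_commute_fun:
  assumes "\<And>x. f (g x) = g (f x)" shows "(f ^^ n) (g x) = g ((f ^^ n) x)"
  by (induction n) (auto simp: assms)

lemma bounded_linear_funpow:
  assumes "bounded_linear (f :: 'a::real_normed_vector \<Rightarrow> 'a)" shows "bounded_linear (f ^^ n)"
proof (induction n)
  case (Suc n)
  then show ?case using bounded_linear_compose[OF assms Suc] by (simp add: o_def)
qed (simp add: id_def bounded_linear_ident)

text \<open>The difference of the powers telescopes into \<open>n\<close> terms, each a product of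
  \<open>n - 1\<close> contractions applied to \<open>f x - g x\<close>; commutativity allows this
  difference to be applied first.\<close>

lemma funpow_diff_contractions_le:
  fixes f g :: "'a::real_normed_vector \<Rightarrow> 'a"
  assumes f: "bounded_linear f" "\<And>x. norm (f x) \<le> norm x"
    and g: "bounded_linear g" "\<And>x. norm (g x) \<le> norm x" and fg: "\<And>x. f (g x) = g (f x)"
  shows "norm ((f ^^ n) x - (g ^^ n) x) \<le> real n * norm (f x - g x)"
proof (induction n arbitrary: x)
  case (Suc n)
  interpret fn: bounded_linear "f ^^ n" by (rule bounded_linear_funpow[OF f(1)])
  interpret g: bounded_linear g by (rule g(1))
  have "(f ^^ Suc n) x - (g ^^ Suc n) x = (f ^^ n) (f x - g x) + ((f ^^ n) (g x) - (g ^^ n) (g x))"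
    by (simp add: fn.diff funpow_swap1)
  then have "norm ((f ^^ Suc n) x - (g ^^ Suc n) x)
      \<le> norm ((f ^^ n) (f x - g x)) + norm ((f ^^ n) (g x) - (g ^^ n) (g x))"
    by (metis norm_triangle_ineq)
  also have "\<dots> \<le> norm (f x - g x) + real n * norm (f (g x) - g (g x))"
    by (intro add_mono norm_funpow_le f Suc)
  also have "\<dots> \<le> norm (f x - g x) + real n * norm (f x - g x)"
    using g(2)[of "f x - g x"] by (intro add_left_mono mult_left_mono) (simp_all add: fg g.diff)
  finally show ?case by (simp add: algebra_simps)
qed simp

lemma funpow_commuting_comp:
  assumes "\<And>x. f (g x) = g (f x)"
  shows "(f ^^ n) ((g ^^ n) x) = ((\<lambda>x. f (g x)) ^^ n) x"
proof (induction n arbitrary: x)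
  case (Suc n)
  have "(f ^^ Suc n) ((g ^^ Suc n) x) = f ((f ^^ n) (g ((g ^^ n) x)))" by simp
  also have "\<dots> = f (g ((f ^^ n) ((g ^^ n) x)))"
    by (simp add: funpow_commute_fun[of f g, OF assms])
  finally show ?case by (simp add: Suc)
qed simp

lemma tendsto_nonexpansive_dense:
  fixes L :: "'b \<Rightarrow> 'a::real_normed_vector \<Rightarrow> 'c::real_normed_vector"
  assumes L: "eventually (\<lambda>h. \<forall>x y. norm (L h x - L h y) \<le> norm (x - y)) F"
    and M: "\<And>x y. norm (M x - M y) \<le> norm (x - y)"
    and dense: "closure S = UNIV" and S: "\<And>x. x \<in> S \<Longrightarrow> ((\<lambda>h. L h x) \<longlongrightarrow> M x) F"
  shows "((\<lambda>h. L h x) \<longlongrightarrow> M x) F"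
proof (rule tendstoI)
  fix e :: real assume "0 < e"
  then obtain y where y: "y \<in> S" "dist y x < e / 3"
    using dense closure_approachable[of x S] by (metis UNIV_I divide_pos_pos zero_less_numeral)
  have "eventually (\<lambda>h. dist (L h y) (M y) < e / 3) F"
    using S[OF y(1)] \<open>0 < e\<close> by (intro tendstoD) auto
  with L show "eventually (\<lambda>h. dist (L h x) (M x) < e) F"
  proof eventually_elim
    case (elim h)
    have "norm (L h x - L h y) \<le> norm (x - y)" using elim by blast
    moreover have "dist (L h x) (M x) \<le> dist (L h x) (L h y) + dist (L h y) (M y) + dist (M y) (M x)"
      using dist_triangle[of "L h x" "M x" "L h y"] dist_triangle[of "L h y" "M x" "M y"] by linarith
    ultimately show ?case
      using M[of x y] y(2) elim(2) unfolding dist_norm by (simp add: norm_minus_commute)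
  qed
qed

lemma convergent_nonexpansive_dense:
  fixes L :: "nat \<Rightarrow> 'a::real_normed_vector \<Rightarrow> 'c::banach"
  assumes L: "\<And>k x y. norm (L k x - L k y) \<le> norm (x - y)"
    and dense: "closure S = UNIV" and S: "\<And>x. x \<in> S \<Longrightarrow> convergent (\<lambda>k. L k x)"
  shows "convergent (\<lambda>k. L k x)"
  unfolding Cauchy_convergent_iff[symmetric]
proof (rule metric_CauchyI)
  fix e :: real assume "0 < e"
  then obtain y where y: "y \<in> S" "dist y x < e / 3"
    using dense closure_approachable[of x S] by (metis UNIV_I divide_pos_pos zero_less_numeral)
  have "Cauchy (\<lambda>k. L k y)" using S[OF y(1)] by (rule convergent_Cauchy)
  then obtain M where M: "\<And>m n. m \<ge> M \<Longrightarrow> n \<ge> M \<Longrightarrow> dist (L m y) (L n y) < e / 3"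
    using metric_CauchyD[of "\<lambda>k. L k y" "e / 3"] \<open>0 < e\<close> by auto
  have "dist (L m x) (L n x) < e" if "m \<ge> M" "n \<ge> M" for m n
  proof -
    have "dist (L m x) (L n x) \<le> dist (L m x) (L m y) + dist (L m y) (L n y) + dist (L n y) (L n x)"
      using dist_triangle[of "L m x" "L n x" "L m y"] dist_triangle[of "L m y" "L n x" "L n y"] by linarith
    then show ?thesis
      using M[OF that] L[of m x y] L[of n y x] y(2) by (simp add: dist_norm norm_minus_commute)
  qed
  then show "\<exists>M. \<forall>m\<ge>M. \<forall>n\<ge>M. dist (L m x) (L n x) < e" by blast
qed

lemma bounded_linear_eq_on_dense:
  assumes "bounded_linear f" "bounded_linear g" "closure S = UNIV" "\<And>x. x \<in> S \<Longrightarrow> f x = g x"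
  shows "f x = g x"
proof -
  have "closed {x. f x = g x}"
    using assms(1,2) by (intro closed_Collect_eq linear_continuous_on)
  then have "closure S \<subseteq> {x. f x = g x}" using assms(4) by (intro closure_minimal) auto
  then show ?thesis using assms(3) by auto
qed

lemma nonexpansive_if_linear_contraction:
  assumes "bounded_linear f" "\<And>x. norm (f x) \<le> norm x"
  shows "norm (f x - f y) \<le> norm (x - y)"
  using assms(2)[of "x - y"] by (simp add: bounded_linear.axioms linear_diff assms(1))

section \<open>The semigroup of a densely defined maximal dissipative operator\<close>

locale dense_m_dissipative = m_dissipative +
  assumes dense: "closure D = UNIV"
begin

lemma J_nonexpansive: "0 < h \<Longrightarrow> norm (J h x - J h y) \<le> norm (x - y)"
  by (intro nonexpansive_if_linear_contraction J_bounded_linear norm_J_le)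

lemma J_tendsto: "((\<lambda>h. J h x) \<longlongrightarrow> x) (at_right 0)"
proof (rule tendsto_nonexpansive_dense[where M = "\<lambda>x. x", OF _ _ dense])
  show "\<forall>\<^sub>F h in at_right 0. \<forall>x y. norm (J h x - J h y) \<le> norm (x - y)"
    using eventually_at_right_less[of 0] by eventually_elim (auto intro: J_nonexpansive)
  fix x assume x: "x \<in> D"
  show "((\<lambda>h. J h x) \<longlongrightarrow> x) (at_right 0)"
  proof (rule Lim_null[THEN iffD2], rule Lim_null_comparison)
    show "\<forall>\<^sub>F h in at_right 0. norm (J h x - x) \<le> h * norm (A x)"
      using eventually_at_right_less[of 0] by eventually_elim (auto intro: norm_J_diff_le x)
    show "((\<lambda>h. h * norm (A x)) \<longlongrightarrow> 0) (at_right 0)"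
      by (auto intro!: tendsto_eq_intros)
  qed
qed simp

text \<open>For \<open>x \<in> D\<close> the vectors \<open>J h x\<close> lie in the domain of the
  square of \<open>A\<close>, since \<open>A (J h x) = J h (A x)\<close>, and they converge to
  \<open>x\<close>.\<close>

lemma dense_sq: "closure {x \<in> D. A x \<in> D} = UNIV"
proof -
  have "D \<subseteq> closure {x \<in> D. A x \<in> D}"
  proof
    fix x assume x: "x \<in> D"
    show "x \<in> closure {x \<in> D. A x \<in> D}"
    proof (rule Lim_in_closed_set[OF closed_closure _ _ J_tendsto])
      show "\<forall>\<^sub>F h in at_right 0. J h x \<in> closure {x \<in> D. A x \<in> D}"
        using eventually_at_right_less[of 0]
        by eventually_elim (auto intro!: subsetD[OF closure_subset] J_in simp: J_A[symmetric] x)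
    qed simp
  qed
  then have "closure D \<subseteq> closure {x \<in> D. A x \<in> D}" by (intro closure_minimal) auto
  then show ?thesis using dense by auto
qed

text \<open>
  Backward Euler with dyadic step sizes. On \<open>{x \<in> D. A x \<in> D}\<close> the local error
  \<open>\<parallel>J a (J b x) - J (a + b) x\<parallel> \<le> a b \<parallel>A (A x)\<parallel>\<close> yields both convergence and the semigroup law.
\<close>

definition V :: "nat \<Rightarrow> real \<Rightarrow> 'a \<Rightarrow> 'a" where
  "V k t = J (t / 2 ^ k) ^^ 2 ^ k"

lemma V_bounded_linear: "0 < t \<Longrightarrow> bounded_linear (V k t)"
  unfolding V_def by (intro bounded_linear_funpow J_bounded_linear) simp

lemma norm_V_le: "0 < t \<Longrightarrow> norm (V k t x) \<le> norm x"
  unfolding V_def by (intro norm_funpow_le norm_J_le) simp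

lemma V_nonexpansive: "0 < t \<Longrightarrow> norm (V k t x - V k t y) \<le> norm (x - y)"
  by (intro nonexpansive_if_linear_contraction V_bounded_linear norm_V_le)

lemma J_J_bounded_linear: "0 < a \<Longrightarrow> 0 < b \<Longrightarrow> bounded_linear (\<lambda>x. J a (J b x))"
  by (intro bounded_linear_compose[of "J a" "J b"] J_bounded_linear)

lemma norm_J_J_funpow_diff_le:
  assumes a: "0 < a" and b: "0 < b" and x: "x \<in> D" "A x \<in> D"
  shows "norm (((\<lambda>x. J a (J b x)) ^^ n) x - (J (a + b) ^^ n) x) \<le> real n * (a * b * norm (A (A x)))"
proof -
  have "norm (((\<lambda>x. J a (J b x)) ^^ n) x - (J (a + b) ^^ n) x) \<le> real n * norm (J a (J b x) - J (a + b) x)"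
    using a b norm_J_le[OF a] norm_J_le[OF b]
    by (intro funpow_diff_contractions_le J_J_bounded_linear J_bounded_linear norm_J_le)
      (auto intro: order_trans simp: J_J_comm)
  also have "\<dots> \<le> real n * (a * b * norm (A (A x)))"
    using norm_J_J_diff_le[OF a b x] by (intro mult_left_mono) auto
  finally show ?thesis .
qed

lemma norm_V_Suc_diff_le:
  assumes t: "0 < t" and x: "x \<in> D" "A x \<in> D"
  shows "norm (V (Suc k) t x - V k t x) \<le> (t\<^sup>2 / 4 * norm (A (A x))) * (1 / 2) ^ k"
proof -
  \<comment> \<open>\<open>V k\<close> makes \<open>2 ^ k\<close> steps of length
    \<open>h + h\<close>, and \<open>V (Suc k)\<close> replaces each by two steps of length
    \<open>h\<close>. The local error \<open>h^2\<close> times \<open>2 ^ k\<close> steps gives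
    \<open>t^2 / 4 * (1 / 2) ^ k\<close>, which is summable in \<open>k\<close>.\<close>
  define h where "h = t / 2 ^ Suc k"
  have h: "0 < h" "t / 2 ^ k = h + h" using t by (simp_all add: h_def)
  have "V (Suc k) t = J h ^^ (2 * 2 ^ k)" by (simp only: V_def h_def power_Suc)
  also have "\<dots> = (J h ^^ 2) ^^ 2 ^ k" by (rule funpow_mult[symmetric])
  also have "J h ^^ 2 = (\<lambda>x. J h (J h x))" by (simp add: numeral_2_eq_2 fun_eq_iff)
  finally have "V (Suc k) t = (\<lambda>x. J h (J h x)) ^^ 2 ^ k" .
  moreover have "V k t = J (h + h) ^^ 2 ^ k" by (simp add: V_def h)
  moreover have "real (2 ^ k) * (h * h * norm (A (A x))) = (t\<^sup>2 / 4 * norm (A (A x))) * (1 / 2) ^ k"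
    by (simp add: h_def field_simps power2_eq_square)
  ultimately show ?thesis using norm_J_J_funpow_diff_le[OF h(1) h(1) x, of "2 ^ k"] by presburger
qed

lemma V_convergent:
  assumes t: "0 < t" shows "convergent (\<lambda>k. V k t x)"
proof (rule convergent_nonexpansive_dense[OF V_nonexpansive[OF t] dense_sq])
  fix x assume x: "x \<in> {x \<in> D. A x \<in> D}"
  have "summable (\<lambda>k. (t\<^sup>2 / 4 * norm (A (A x))) * (1 / 2) ^ k)"
    by (intro summable_mult summable_geometric) simp
  then have "summable (\<lambda>k. V (Suc k) t x - V k t x)"
    by (rule summable_comparison_test') (use norm_V_Suc_diff_le[OF t, of x] x in blast)
  then have "(\<lambda>n. V n t x - V 0 t x) \<longlonglongrightarrow> (\<Sum>k. V (Suc k) t x - V k t x)"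
    by (subst sum_lessThan_telescope[symmetric]) (rule summable_LIMSEQ)
  then have "(\<lambda>n. V n t x - V 0 t x + V 0 t x) \<longlonglongrightarrow> (\<Sum>k. V (Suc k) t x - V k t x) + V 0 t x"
    by (intro tendsto_intros)
  then show "convergent (\<lambda>k. V k t x)" by (auto simp: convergent_def)
qed

text \<open>The value \<open>x\<close> for \<open>t \<le> 0\<close> gives the identity at time 0,
  where no Euler step is available, and makes \<open>T t\<close> a linear contraction for every real
  \<open>t\<close>.\<close>

definition T :: "real \<Rightarrow> 'a \<Rightarrow> 'a" where
  "T t x = (if t \<le> 0 then x else lim (\<lambda>k. V k t x))"

lemma T_0: "T 0 = id"
  by (auto simp: T_def)

lemma V_tendsto: "0 < t \<Longrightarrow> (\<lambda>k. V k t x) \<longlonglongrightarrow> T t x"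
  using V_convergent by (simp add: T_def convergent_LIMSEQ_iff)

lemma norm_T_le: "norm (T t x) \<le> norm x"
proof (cases "0 < t")
  case True
  show ?thesis
    by (rule Lim_bounded[OF tendsto_norm[OF V_tendsto[OF True]]]) (auto intro: norm_V_le True)
qed (simp add: T_def)

lemma T_bounded_linear: "bounded_linear (T t)"
proof (cases "0 < t")
  case True
  show ?thesis
  proof (rule bounded_linear_intro[where K = 1])
    fix x y and r :: real
    interpret V: bounded_linear "V k t" for k by (rule V_bounded_linear[OF True])
    have "(\<lambda>k. V k t (x + y)) \<longlonglongrightarrow> T t x + T t y"
      unfolding V.add by (intro tendsto_add V_tendsto True)
    then show "T t (x + y) = T t x + T t y" using V_tendsto[OF True] LIMSEQ_unique by blast
    have "(\<lambda>k. V k t (r *\<^sub>R x)) \<longlonglongrightarrow> r *\<^sub>R T t x"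
      unfolding V.scaleR by (intro tendsto_intros V_tendsto True)
    then show "T t (r *\<^sub>R x) = r *\<^sub>R T t x" using V_tendsto[OF True] LIMSEQ_unique by blast
  qed (simp add: norm_T_le)
next
  case False
  then have "T t = (\<lambda>x. x)" by (auto simp: T_def)
  then show ?thesis by simp
qed

lemma T_comm:
  assumes "bounded_linear L" "\<And>x. x \<in> D \<Longrightarrow> L x \<in> D \<and> A (L x) = L (A x)"
  shows "T t (L x) = L (T t x)"
proof (cases "0 < t")
  case True
  have "V k t (L x) = L (V k t x)" for k
    unfolding V_def using True by (intro funpow_commute_fun J_comm assms) auto
  then have "(\<lambda>k. V k t (L x)) \<longlonglongrightarrow> L (T t x)"
    using bounded_linear.tendsto[OF assms(1) V_tendsto[OF True]] by simp
  then show ?thesis using V_tendsto[OF True] LIMSEQ_unique by blast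
qed (simp add: T_def)

text \<open>At level \<open>k\<close> both \<open>V k s\<close> and \<open>V k t\<close> consist of
  \<open>2 ^ k\<close> steps, so commuting steps can be paired and each pair compared with one step
  of length \<open>(s + t) / 2 ^ k\<close>. The total error is \<open>2 ^ k\<close> times the
  product of the step lengths and tends to 0. Replacing the inner \<open>V k t x\<close> by
  \<open>T t x\<close> costs nothing in the limit, as \<open>V k s\<close> is nonexpansive.\<close>

lemma T_add:
  assumes "0 \<le> s" "0 \<le> t" shows "T (s + t) = T s \<circ> T t"
proof (cases "s = 0 \<or> t = 0")
  case False
  then have s: "0 < s" and t: "0 < t" using assms by auto
  have "T (s + t) x = T s (T t x)" for x
  proof (rule bounded_linear_eq_on_dense[OF T_bounded_linear _ dense_sq])
    show "bounded_linear (\<lambda>x. T s (T t x))"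
      by (rule bounded_linear_compose[OF T_bounded_linear T_bounded_linear])
    fix x assume x: "x \<in> {x \<in> D. A x \<in> D}"
    have bd: "norm (V k s (V k t x) - V k (s + t) x) \<le> s * t * norm (A (A x)) * (1 / 2) ^ k" for k
    proof -
      let ?a = "s / 2 ^ k" and ?b = "t / 2 ^ k"
      have "V k s (V k t x) = ((\<lambda>x. J ?a (J ?b x)) ^^ 2 ^ k) x"
        unfolding V_def using s t by (intro funpow_commuting_comp J_J_comm) auto
      moreover have "V k (s + t) x = (J (?a + ?b) ^^ 2 ^ k) x"
        by (simp add: V_def add_divide_distrib)
      moreover have "real (2 ^ k) * (?a * ?b * norm (A (A x))) = s * t * norm (A (A x)) * (1 / 2) ^ k"
        by (simp add: field_simps)
      ultimately show ?thesis
        using norm_J_J_funpow_diff_le[of ?a ?b x "2 ^ k"] s t x by simp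
    qed
    have "(\<lambda>k. V k s (V k t x) - V k (s + t) x) \<longlonglongrightarrow> 0"
    proof (rule Lim_null_comparison)
      show "\<forall>\<^sub>F k in sequentially. norm (V k s (V k t x) - V k (s + t) x) \<le> s * t * norm (A (A x)) * (1 / 2) ^ k"
        using bd by simp
      show "(\<lambda>k. s * t * norm (A (A x)) * (1 / 2) ^ k) \<longlonglongrightarrow> 0"
        by (intro tendsto_mult_right_zero LIMSEQ_realpow_zero) auto
    qed
    moreover have "(\<lambda>k. V k s (V k t x) - V k s (T t x)) \<longlonglongrightarrow> 0"
    proof (rule Lim_null_comparison)
      show "\<forall>\<^sub>F k in sequentially. norm (V k s (V k t x) - V k s (T t x)) \<le> norm (V k t x - T t x)"
        by (simp add: V_nonexpansive[OF s])
      show "(\<lambda>k. norm (V k t x - T t x)) \<longlonglongrightarrow> 0"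
        by (intro tendsto_norm_zero Lim_null[THEN iffD1] V_tendsto t)
    qed
    ultimately have "(\<lambda>k. (V k s (V k t x) - V k (s + t) x) - (V k s (V k t x) - V k s (T t x))
        + V k (s + t) x) \<longlonglongrightarrow> 0 - 0 + T (s + t) x"
      using s t by (intro tendsto_intros V_tendsto) auto
    then have "(\<lambda>k. V k s (T t x)) \<longlonglongrightarrow> T (s + t) x" by simp
    then show "T (s + t) x = T s (T t x)" using V_tendsto[OF s] LIMSEQ_unique by blast
  qed
  then show ?thesis by (auto simp: fun_eq_iff)
qed (auto simp: T_0)

text \<open>The powers of \<open>J (t / 2 ^ k)\<close> are compared with those of the identity; the
  \<open>2 ^ k\<close> errors of size \<open>t / 2 ^ k * norm (A x)\<close> add up to a bound free
  of \<open>k\<close>.\<close>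

lemma norm_T_diff_le:
  assumes t: "0 < t" and x: "x \<in> D" shows "norm (T t x - x) \<le> t * norm (A x)"
proof -
  have "norm (V k t x - x) \<le> t * norm (A x)" for k
  proof -
    let ?h = "t / 2 ^ k"
    have h: "0 < ?h" using t by simp
    have "norm ((J ?h ^^ 2 ^ k) x - ((\<lambda>x. x) ^^ 2 ^ k) x) \<le> real (2 ^ k) * norm (J ?h x - x)"
      by (intro funpow_diff_contractions_le J_bounded_linear bounded_linear_ident norm_J_le h) auto
    also have "\<dots> \<le> real (2 ^ k) * (?h * norm (A x))"
      by (intro mult_left_mono norm_J_diff_le h x) auto
    finally show ?thesis by (simp add: V_def flip: id_def)
  qed
  then show ?thesis
    by (intro Lim_bounded[OF tendsto_norm[OF tendsto_diff[OF V_tendsto[OF t] tendsto_const]]]) auto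
qed

text \<open>The Euler scheme starts with \<open>V 0 t = J t\<close>. The level-to-level errors are
  at most \<open>c (1 / 2) ^ k\<close>, whose partial sums are
  \<open>c (2 - 2 (1 / 2) ^ k)\<close>.\<close>

lemma norm_T_J_diff_le:
  assumes t: "0 < t" and x: "x \<in> D" "A x \<in> D"
  shows "norm (T t x - J t x) \<le> t\<^sup>2 / 2 * norm (A (A x))"
proof -
  define c where "c = t\<^sup>2 / 4 * norm (A (A x))"
  have c: "0 \<le> c" by (simp add: c_def)
  have "norm (V k t x - J t x) \<le> c * (2 - 2 * (1 / 2) ^ k)" for k
  proof (induction k)
    case (Suc k)
    have "norm (V (Suc k) t x - J t x) \<le> norm (V (Suc k) t x - V k t x) + norm (V k t x - J t x)"
      by (metis norm_diff_triangle_ineq add.commute diff_add_cancel norm_triangle_ineq diff_add_eq add_diff_eq)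
    then show ?case using Suc norm_V_Suc_diff_le[OF t x, of k, folded c_def] by (simp add: algebra_simps)
  qed (simp add: V_def)
  moreover have "c * (2 - 2 * (1 / 2) ^ k) \<le> 2 * c" for k :: nat
    using c by (simp add: algebra_simps)
  ultimately have "norm (V k t x - J t x) \<le> 2 * c" for k using order_trans by blast
  then have "norm (T t x - J t x) \<le> 2 * c"
    by (intro Lim_bounded[OF tendsto_norm[OF tendsto_diff[OF V_tendsto[OF t] tendsto_const]]]) auto
  then show ?thesis by (simp add: c_def mult.commute)
qed

lemma T_tendsto_0: "((\<lambda>t. T t x) \<longlongrightarrow> x) (at_right 0)"
proof (rule tendsto_nonexpansive_dense[where M = "\<lambda>x. x", OF _ _ dense])
  show "\<forall>\<^sub>F h in at_right 0. \<forall>x y. norm (T h x - T h y) \<le> norm (x - y)"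
    by (intro always_eventually allI nonexpansive_if_linear_contraction T_bounded_linear norm_T_le)
  fix x assume x: "x \<in> D"
  show "((\<lambda>h. T h x) \<longlongrightarrow> x) (at_right 0)"
  proof (rule Lim_null[THEN iffD2], rule Lim_null_comparison)
    show "\<forall>\<^sub>F h in at_right 0. norm (T h x - x) \<le> h * norm (A x)"
      using eventually_at_right_less[of 0] by eventually_elim (auto intro: norm_T_diff_le x)
    show "((\<lambda>h. h * norm (A x)) \<longlongrightarrow> 0) (at_right 0)"
      by (auto intro!: tendsto_eq_intros)
  qed
qed simp

lemma norm_T_derivative_le:
  assumes h: "0 < h" and y: "y \<in> D" "A y \<in> D"
  shows "norm (T h y - y - h *\<^sub>R A y) \<le> 2 * h\<^sup>2 * norm (A (A y))"
proof -
  have "T h y - y - h *\<^sub>R A y = (T h y - J h y) + h *\<^sub>R (J h (A y) - A y)"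
    using J_diff[OF h y(1)] by (simp add: algebra_simps)
  then have "norm (T h y - y - h *\<^sub>R A y) \<le> norm (T h y - J h y) + norm (h *\<^sub>R (J h (A y) - A y))"
    by (simp only: norm_triangle_ineq)
  also have "\<dots> \<le> h\<^sup>2 / 2 * norm (A (A y)) + h * (h * norm (A (A y)))"
    using norm_T_J_diff_le[OF h y] norm_J_diff_le[OF h y(2)] h by (intro add_mono) simp_all
  also have "\<dots> \<le> 2 * h\<^sup>2 * norm (A (A y))"
    using h by (simp add: power2_eq_square)
  finally show ?thesis .
qed

text \<open>The quadratic estimate holds only on the domain of the square of \<open>A\<close>. A
  general \<open>x\<close> is replaced by \<open>y = J d x\<close>, which is close to
  \<open>x\<close> in the sense that \<open>A (x - y)\<close> is small; the remainder is linear in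
  \<open>h\<close> with this small factor. The budget is one \<open>e / 4\<close> for
  \<open>y\<close> and two for \<open>x - y\<close>.\<close>

lemma T_derivative:
  assumes x: "x \<in> D" shows "((\<lambda>h. (T h x - x) /\<^sub>R h) \<longlongrightarrow> A x) (at_right 0)"
proof (rule tendstoI)
  fix e :: real assume e: "0 < e"
  have "\<forall>\<^sub>F d in at_right 0. 0 < d \<and> dist (J d (A x)) (A x) < e / 4"
    using e by (intro eventually_conj eventually_at_right_less tendstoD[OF J_tendsto]) auto
  then obtain d where d: "0 < d" "dist (J d (A x)) (A x) < e / 4"
    using eventually_happens[of _ "at_right (0::real)"] by auto
  define y where "y = J d x"
  have y: "y \<in> D" "A y \<in> D" using d(1) x by (simp_all add: y_def J_in flip: J_A)
  have Axy: "norm (A (x - y)) < e / 4"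
    using d x y by (simp add: A_diff y_def J_A dist_norm norm_minus_commute)
  have xy: "x - y \<in> D" using x y subspace_diff[OF subspace_D] by blast
  have "((\<lambda>h. 2 * h * norm (A (A y))) \<longlongrightarrow> 0) (at_right 0)"
    by (auto intro!: tendsto_eq_intros)
  then have "\<forall>\<^sub>F h in at_right 0. 2 * h * norm (A (A y)) < e / 4"
    using e by (intro order_tendstoD) auto
  with eventually_at_right_less[of 0]
  show "\<forall>\<^sub>F h in at_right 0. dist ((T h x - x) /\<^sub>R h) (A x) < e"
  proof eventually_elim
    case (elim h)
    interpret T: bounded_linear "T h" by (rule T_bounded_linear)
    have "T h x - x - h *\<^sub>R A x =
        ((T h y - y - h *\<^sub>R A y) + (T h (x - y) - (x - y))) - h *\<^sub>R A (x - y)"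
      using x y by (simp add: T.diff A_diff algebra_simps)
    then have "norm (T h x - x - h *\<^sub>R A x) \<le>
        norm (T h y - y - h *\<^sub>R A y) + norm (T h (x - y) - (x - y)) + norm (h *\<^sub>R A (x - y))"
      by (smt (verit) norm_triangle_ineq norm_triangle_ineq4)
    also have "\<dots> \<le> 2 * h\<^sup>2 * norm (A (A y)) + h * norm (A (x - y)) + h * norm (A (x - y))"
      using elim norm_T_derivative_le[OF _ y, of h] norm_T_diff_le[OF _ xy, of h]
      by (intro add_mono) simp_all
    also have "\<dots> = h * (2 * h * norm (A (A y)) + 2 * norm (A (x - y)))"
      by (simp add: power2_eq_square algebra_simps)
    also have "2 * h * norm (A (A y)) + 2 * norm (A (x - y)) < e"
      using elim(2) Axy e by linarith
    then have "h * (2 * h * norm (A (A y)) + 2 * norm (A (x - y))) < h * e"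
      using elim(1) by (rule mult_strict_left_mono)
    finally have *: "norm (T h x - x - h *\<^sub>R A x) < h * e" .
    have "(T h x - x) /\<^sub>R h - A x = (1 / h) *\<^sub>R (T h x - x - h *\<^sub>R A x)"
      using elim(1) by (simp add: scaleR_diff_right divide_inverse)
    then have "dist ((T h x - x) /\<^sub>R h) (A x) = norm (T h x - x - h *\<^sub>R A x) / h"
      unfolding dist_norm using elim(1) by simp
    then show ?case using * elim(1) by (simp add: pos_divide_less_eq mult.commute)
  qed
qed

text \<open>The right derivative at 0 defines an extension of \<open>A\<close>; that it is no proper
  extension follows from surjectivity of \<open>I - A\<close> together with contractivity of the
  semigroup.\<close>

lemma T_derivative_iff:
  "x \<in> D \<and> A x = z \<longleftrightarrow> ((\<lambda>h. (T h x - x) /\<^sub>R h) \<longlongrightarrow> z) (at_right 0)"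
proof
  assume "((\<lambda>h. (T h x - x) /\<^sub>R h) \<longlongrightarrow> z) (at_right 0)"
  \<comment> \<open>\<open>w\<close> solves \<open>w - A w = x - z\<close>, so
    \<open>v = x - w\<close> has right derivative \<open>z - A w = v\<close>. Growth at rate 1
    contradicts \<open>norm (T h v) \<le> norm v\<close> unless \<open>v = 0\<close>.\<close>
  moreover define w where "w = J 1 (x - z)"
  have w: "w \<in> D" "w - A w = x - z" using J_in[of 1 "x - z"] J_eq[of 1 "x - z"] by (simp_all add: w_def)
  ultimately have "((\<lambda>h. (T h x - x) /\<^sub>R h - (T h w - w) /\<^sub>R h) \<longlongrightarrow> z - A w) (at_right 0)"
    by (intro tendsto_diff T_derivative)
  moreover have "z - A w = x - w" using w(2) by (simp add: algebra_simps)
  moreover have "(T h x - x) /\<^sub>R h - (T h w - w) /\<^sub>R h = (T h (x - w) - (x - w)) /\<^sub>R h" for h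
    by (simp add: linear_diff[OF bounded_linear.linear[OF T_bounded_linear]] algebra_simps)
  ultimately have "((\<lambda>h. (T h (x - w) - (x - w)) /\<^sub>R h - (x - w)) \<longlongrightarrow> 0) (at_right 0)"
    using Lim_null by fastforce
  from tendsto_norm[OF this]
  have lim: "((\<lambda>h. norm ((T h (x - w) - (x - w)) /\<^sub>R h - (x - w))) \<longlongrightarrow> 0) (at_right 0)" by simp
  have "\<forall>\<^sub>F h in at_right 0. norm (x - w) \<le> norm ((T h (x - w) - (x - w)) /\<^sub>R h - (x - w))"
    using eventually_at_right_less[of 0]
  proof eventually_elim
    case (elim h)
    let ?v = "x - w" and ?r = "(T h (x - w) - (x - w)) /\<^sub>R h - (x - w)"
    have "T h ?v = (1 + h) *\<^sub>R ?v + h *\<^sub>R ?r" using elim by (simp add: algebra_simps)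
    then have "norm ((1 + h) *\<^sub>R ?v) \<le> norm (T h ?v) + norm (h *\<^sub>R ?r)"
      using norm_triangle_ineq4[of "T h ?v" "h *\<^sub>R ?r"] by (metis add_diff_cancel_right')
    then have "(1 + h) * norm ?v \<le> norm ?v + h * norm ?r"
      using norm_T_le[of h ?v] elim by (simp del: scaleR_add_left)
    then have "h * norm ?v \<le> h * norm ?r" by (simp add: algebra_simps)
    then show ?case using elim by simp
  qed
  with lim have "norm (x - w) \<le> 0" by (rule tendsto_lowerbound) simp
  then have "x = w" by simp
  then show "x \<in> D \<and> A x = z" using w by simp
qed (use T_derivative in auto)

end

section \<open>Inner products\<close>

lemma rc_re_conj: "rc_re (rc_conj c) = rc_re (c :: 'k::rc_scalar)"
proof -
  have "of_real (2 * rc_re (rc_conj c)) = (of_real (2 * rc_re c) :: 'k)"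
    using rc_add_conj[of c] rc_add_conj[of "rc_conj c"] by (simp add: rc_conj_conj add.commute)
  then show ?thesis by (simp only: of_real_eq_iff)
qed

lemma rc_re_of_real_mult: "rc_re (of_real r * c) = r * rc_re (c :: 'k::rc_scalar)"
proof -
  have "of_real (2 * rc_re (of_real r * c)) = (of_real r * (c + rc_conj c) :: 'k)"
    by (simp only: rc_add_conj[symmetric] rc_conj_mult rc_conj_of_real distrib_left)
  also have "\<dots> = of_real (2 * (r * rc_re c))" by (simp add: rc_add_conj)
  finally show ?thesis by (simp only: of_real_eq_iff)
qed

locale hilbert =
  fixes H :: "('k::rc_scalar, 'a::banach) inner_structure"
  assumes hilbert: "hilbert_space H"
begin

sublocale vector_space "scal H"
  using hilbert by (simp add: hilbert_space_def)

lemma scal_of_real: "scal H (of_real r) x = r *\<^sub>R x"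
  using hilbert by (auto simp: hilbert_space_def)

lemma
  shows ip_add_left: "ip H (x + y) z = ip H x z + ip H y z"
    and ip_scal_left: "ip H (scal H c x) y = c * ip H x y"
    and ip_commute: "ip H y x = rc_conj (ip H x y)"
    and re_ip_norm: "rc_re (ip H x x) = (norm x)\<^sup>2"
  using hilbert unfolding hilbert_space_def by metis+

definition re_ip :: "'a \<Rightarrow> 'a \<Rightarrow> real" where
  "re_ip x y = rc_re (ip H x y)"

lemma re_ip_commute: "re_ip x y = re_ip y x"
  by (simp add: re_ip_def ip_commute[of y x] rc_re_conj)

lemma re_ip_add_left: "re_ip (x + y) z = re_ip x z + re_ip y z"
  by (simp add: re_ip_def ip_add_left rc_re_add)

lemma re_ip_scaleR_left: "re_ip (r *\<^sub>R x) y = r * re_ip x y"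
  by (simp add: re_ip_def ip_scal_left rc_re_of_real_mult flip: scal_of_real)

lemma re_ip_self: "re_ip x x = (norm x)\<^sup>2"
  by (simp add: re_ip_def re_ip_norm)

lemma re_ip_minus_left: "re_ip (- x) y = - re_ip x y"
  using re_ip_scaleR_left[of "-1" x y] by simp

lemma re_ip_zero [simp]: "re_ip 0 x = 0" "re_ip x 0 = 0"
  using re_ip_scaleR_left[of 0 0 x] re_ip_commute[of 0 x] by simp_all

lemma re_ip_diff_left: "re_ip (x - y) z = re_ip x z - re_ip y z"
  using re_ip_add_left[of x "- y" z] by (simp add: re_ip_minus_left)

lemma re_ip_add_right: "re_ip x (y + z) = re_ip x y + re_ip x z"
  by (metis re_ip_add_left re_ip_commute)

lemma re_ip_diff_right: "re_ip x (y - z) = re_ip x y - re_ip x z"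
  by (metis re_ip_diff_left re_ip_commute)

lemma re_ip_scaleR_right: "re_ip x (r *\<^sub>R y) = r * re_ip x y"
  by (metis re_ip_scaleR_left re_ip_commute)

lemmas re_ip_simps = re_ip_add_left re_ip_add_right re_ip_diff_left re_ip_diff_right
  re_ip_scaleR_left re_ip_scaleR_right re_ip_minus_left

lemma norm_diff_sq: "(norm (x - y))\<^sup>2 = (norm x)\<^sup>2 - 2 * re_ip x y + (norm y)\<^sup>2"
  by (simp add: re_ip_simps re_ip_commute[of y x] flip: re_ip_self)

lemma norm_scal: "norm (scal H c x) = norm c * norm x"
proof -
  have c: "ip H (scal H c x) (scal H c x) = of_real ((norm c)\<^sup>2) * ip H x x"
  proof -
    have "ip H (scal H c x) (scal H c x) = c * ip H x (scal H c x)"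
      by (rule ip_scal_left)
    also have "ip H x (scal H c x) = rc_conj (c * ip H x x)"
      unfolding ip_commute[of x "scal H c x"] ip_scal_left ..
    also have "\<dots> = rc_conj c * ip H x x"
      by (simp add: rc_conj_mult flip: ip_commute)
    finally show ?thesis by (simp only: mult.assoc flip: rc_mult_conj)
  qed
  have "(norm (scal H c x))\<^sup>2 = (norm c * norm x)\<^sup>2"
    by (simp add: re_ip_self[symmetric] re_ip_def c rc_re_of_real_mult power_mult_distrib del: of_real_power)
  then show ?thesis by simp
qed

lemma scal_bounded_linear: "bounded_linear (scal H c)"
proof (rule bounded_linear_intro[where K = "norm c"])
  show "scal H c (r *\<^sub>R x) = r *\<^sub>R scal H c x" for r x
    by (simp flip: scal_of_real add: mult.commute)
qed (simp_all add: scale_right_distrib norm_scal mult.commute)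

text \<open>Being fixed by conjugation, \<open>ip H x x\<close> is the real scalar
  \<open>(norm x)^2\<close>, which can then be pulled out of the real part.\<close>

lemma re_ip_scal_self: "re_ip (scal H c x) x = rc_re c * (norm x)\<^sup>2"
proof -
  have "2 * ip H x x = of_real (2 * rc_re (ip H x x))"
    unfolding rc_add_conj[symmetric] by (simp flip: ip_commute)
  then have "ip H x x = of_real ((norm x)\<^sup>2)"
    by (simp add: re_ip_norm)
  then have "ip H (scal H c x) x = of_real ((norm x)\<^sup>2) * c"
    by (simp add: ip_scal_left mult.commute)
  then show ?thesis by (simp only: re_ip_def rc_re_of_real_mult) (rule mult.commute)
qed

lemma subspace_real: "subspace D \<Longrightarrow> real_vector.subspace D"
  unfolding real_vector.subspace_def subspace_def by (metis scal_of_real)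

lemma norm_le_if_re_ip_nonpos:
  assumes "re_ip y x \<le> 0" "0 < h" shows "norm x \<le> norm (x - h *\<^sub>R y)"
proof -
  have "h * re_ip x y \<le> 0" using assms by (simp add: re_ip_commute[of x] mult_le_0_iff)
  then have "(norm x)\<^sup>2 \<le> (norm (x - h *\<^sub>R y))\<^sup>2"
    unfolding norm_diff_sq re_ip_simps using zero_le_power2[of "norm (h *\<^sub>R y)"] by linarith
  then show ?thesis by (simp add: power2_le_iff_abs_le)
qed

text \<open>This is the Lax-Milgram argument: \<open>T x = y\<close> is solved as a fixed point of
  \<open>x - e (T x - y)\<close>, a contraction for small \<open>e\<close>.\<close>

lemma coercive_bij:
  assumes T: "bounded_linear T" and c: "0 < c" "\<And>x. c * (norm x)\<^sup>2 \<le> re_ip (T x) x"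
  shows "bij T" "bounded_linear (inv T)"
proof -
  interpret T: bounded_linear T by fact
  obtain M0 where M0: "\<And>x. norm (T x) \<le> norm x * M0" using T.bounded by blast
  \<comment> \<open>Taking the maximum with \<open>c\<close> ensures \<open>M > 0\<close> and
    \<open>q \<ge> 0\<close>. The choice \<open>e = c / M^2\<close> minimizes the bound
    \<open>1 - 2 e c + e^2 M^2\<close>, and \<open>q\<close> is the minimum.\<close>
  define M where "M = max M0 c"
  have M: "0 < M" "c \<le> M" "norm (T x) \<le> norm x * M" for x
    using c(1) order_trans[OF M0 mult_left_mono[of M0 M "norm x"]] by (auto simp: M_def)
  define e where "e = c / M\<^sup>2"
  define q where "q = 1 - c\<^sup>2 / M\<^sup>2"
  have e: "0 < e" using c M by (simp add: e_def)
  have step: "(norm (x - e *\<^sub>R T x))\<^sup>2 \<le> q * (norm x)\<^sup>2" for x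
  proof -
    have "(norm (T x))\<^sup>2 \<le> (norm x * M)\<^sup>2" by (intro power_mono M) auto
    then have "e\<^sup>2 * (norm (T x))\<^sup>2 \<le> e\<^sup>2 * (norm x * M)\<^sup>2" by (intro mult_left_mono) auto
    moreover have "2 * e * (c * (norm x)\<^sup>2) \<le> 2 * e * re_ip (T x) x"
      using c(2)[of x] e by (intro mult_left_mono) auto
    moreover have "(norm x)\<^sup>2 - 2 * e * (c * (norm x)\<^sup>2) + e\<^sup>2 * (norm x * M)\<^sup>2 = q * (norm x)\<^sup>2"
      using M by (simp add: e_def q_def field_simps power2_eq_square)
    ultimately show ?thesis
      by (simp add: norm_diff_sq re_ip_simps re_ip_commute[of x] power_mult_distrib)
  qed
  have inj: "inj T"
  proof (rule injI)
    fix x y assume "T x = T y"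
    then have "c * (norm (x - y))\<^sup>2 \<le> 0" using c(2)[of "x - y"] by (simp add: T.diff)
    then show "x = y" using c(1) by (simp add: mult_le_0_iff)
  qed
  have "\<exists>x. T x = y" for y
  proof -
    have q: "0 \<le> q" "q < 1"
      using c M power_mono[of c M 2] by (simp_all add: q_def)
    have "dist (x - e *\<^sub>R (T x - y)) (z - e *\<^sub>R (T z - y)) \<le> sqrt q * dist x z" for x z
    proof -
      have "(norm ((x - z) - e *\<^sub>R T (x - z)))\<^sup>2 \<le> (sqrt q * norm (x - z))\<^sup>2"
        using step[of "x - z"] q by (simp add: power_mult_distrib)
      then have "norm ((x - z) - e *\<^sub>R T (x - z)) \<le> sqrt q * norm (x - z)"
        by (rule power2_le_imp_le) (simp add: q)
      then show ?thesis by (simp add: dist_norm T.diff algebra_simps)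
    qed
    then obtain x where "x - e *\<^sub>R (T x - y) = x"
      using banach_fix_type[of "sqrt q" "\<lambda>x. x - e *\<^sub>R (T x - y)"] q by auto
    then show ?thesis using e by auto
  qed
  then show bij: "bij T" using inj by (metis bijI surj_def)
  have T_inv: "T (inv T y) = y" for y using bij by (simp add: bij_is_surj surj_f_inv_f)
  have inv_eqI: "inv T y = x" if "T x = y" for x y using inj that by (simp add: inv_f_eq)
  show "bounded_linear (inv T)"
  proof (rule bounded_linear_intro[where K = "1 / c"])
    fix y
    define x where "x = inv T y"
    \<comment> \<open>Coercivity says that \<open>c I - T\<close> is dissipative; its resolvent
      estimate with \<open>h = 1 / c\<close> is precisely
      \<open>norm x \<le> norm (T x) / c\<close>.\<close>
    have "re_ip (- (T x - c *\<^sub>R x)) x \<le> 0" using c(2)[of x] by (simp add: re_ip_simps re_ip_self)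
    then have "norm x \<le> norm (x - (1 / c) *\<^sub>R - (T x - c *\<^sub>R x))"
      using c(1) by (intro norm_le_if_re_ip_nonpos) simp_all
    also have "x - (1 / c) *\<^sub>R - (T x - c *\<^sub>R x) = (1 / c) *\<^sub>R T x"
      using c(1) by (simp add: algebra_simps)
    finally show "norm (inv T y) \<le> norm y * (1 / c)" using c(1) by (simp add: x_def T_inv)
  qed (auto intro!: inv_eqI simp: T.add T.scaleR T_inv)
qed

end

text \<open>
  With \<open>p n = J (1 / (n + 1)) x - x\<close>, monotonicity yields \<open>\<parallel>p m - p n\<parallel>\<^sup>2 \<le> \<parallel>p m\<parallel>\<^sup>2 - \<parallel>p n\<parallel>\<^sup>2\<close> for \<open>m \<le> n\<close>, so
  \<open>p\<close> is Cauchy. As \<open>p n = A ((x + p n) / (n + 1))\<close> and \<open>A\<close> is closed, its limit is \<open>A 0 = 0\<close>.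
\<close>

lemma (in hilbert) m_dissipative_dense:
  assumes "m_dissipative D A" and nonpos: "\<And>x. x \<in> D \<Longrightarrow> re_ip (A x) x \<le> 0"
  shows "closure D = UNIV"
proof -
  interpret m_dissipative D A by fact
  have "x \<in> closure D" for x
  proof -
    define p where "p n = J (1 / real (Suc n)) x - x" for n
    have J_p: "J (1 / real (Suc n)) x = x + p n" for n by (simp add: p_def)
    have in_D: "x + p n \<in> D" for n unfolding J_p[symmetric] by (rule J_in) simp
    have A_p: "A (x + p n) = real (Suc n) *\<^sub>R p n" for n
    proof -
      have "p n = (1 / real (Suc n)) *\<^sub>R A (x + p n)"
        using J_eq[of "1 / real (Suc n)" x] unfolding J_p by (simp add: algebra_simps)
      then have "real (Suc n) *\<^sub>R p n = real (Suc n) *\<^sub>R (1 / real (Suc n)) *\<^sub>R A (x + p n)"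
        by (rule arg_cong)
      then show ?thesis by (simp del: of_nat_Suc)
    qed
    have mono: "(norm (p m - p n))\<^sup>2 \<le> (norm (p m))\<^sup>2 - (norm (p n))\<^sup>2" if "m \<le> n" for m n
    proof -
      define a where "a = real (Suc m)"
      define b where "b = real (Suc n)"
      have ab: "0 < a" "a \<le> b" using that by (simp_all add: a_def b_def)
      have "p m - p n \<in> D" "A (p m - p n) = a *\<^sub>R p m - b *\<^sub>R p n"
        using real_vector.subspace_diff[OF subspace_D in_D in_D, of m n] A_diff[OF in_D in_D, of m n]
        unfolding A_p a_def b_def by simp_all
      then have "re_ip (a *\<^sub>R p m - b *\<^sub>R p n) (p m - p n) \<le> 0"
        using nonpos[of "p m - p n"] by simp
      then have *: "a * (norm (p m))\<^sup>2 + b * (norm (p n))\<^sup>2 \<le> (a + b) * re_ip (p m) (p n)"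
        by (simp add: re_ip_simps re_ip_self re_ip_commute[of "p n" "p m"] algebra_simps)
      \<comment> \<open>The expansion of the left square turns * into this form. Since
        \<open>b - a \<le> a + b\<close>, the factor \<open>a + b\<close> can be cancelled once the
        difference of squares is known to be nonnegative.\<close>
      have "(a + b) * (norm (p m - p n))\<^sup>2 \<le> (b - a) * ((norm (p m))\<^sup>2 - (norm (p n))\<^sup>2)"
        using * unfolding norm_diff_sq by (simp add: algebra_simps)
      moreover have "0 \<le> (a + b) * (norm (p m - p n))\<^sup>2" using ab by simp
      ultimately have **: "0 \<le> (b - a) * ((norm (p m))\<^sup>2 - (norm (p n))\<^sup>2)" 
         "(a + b) * (norm (p m - p n))\<^sup>2 \<le> (b - a) * ((norm (p m))\<^sup>2 - (norm (p n))\<^sup>2)" by linarith+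
      show ?thesis
      proof (cases "a = b")
        case True
        then show ?thesis by (simp add: a_def b_def)
      next
        case False
        then have "0 \<le> (norm (p m))\<^sup>2 - (norm (p n))\<^sup>2"
          using ** ab by (simp add: zero_le_mult_iff)
        then have "(b - a) * ((norm (p m))\<^sup>2 - (norm (p n))\<^sup>2) \<le> (a + b) * ((norm (p m))\<^sup>2 - (norm (p n))\<^sup>2)"
          using ab by (intro mult_right_mono) auto
        then have "(a + b) * (norm (p m - p n))\<^sup>2 \<le> (a + b) * ((norm (p m))\<^sup>2 - (norm (p n))\<^sup>2)"
          using ** by linarith
        then show ?thesis using ab by simp
      qed
    qed
    have "decseq (\<lambda>n. (norm (p n))\<^sup>2)"
      unfolding decseq_def
    proof (intro allI impI)
      fix m n :: nat assume "m \<le> n"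
      then show "(norm (p n))\<^sup>2 \<le> (norm (p m))\<^sup>2"
        using mono[of m n] zero_le_power2[of "norm (p m - p n)"] by linarith
    qed
    then obtain l where "(\<lambda>n. (norm (p n))\<^sup>2) \<longlonglongrightarrow> l"
      by (rule decseq_convergent[where B = 0]) simp
    then have C: "Cauchy (\<lambda>n. (norm (p n))\<^sup>2)" by (rule LIMSEQ_imp_Cauchy)
    have "Cauchy p"
    proof (rule metric_CauchyI)
      fix e :: real assume e: "0 < e"
      then obtain M where M: "\<And>m n. m \<ge> M \<Longrightarrow> n \<ge> M \<Longrightarrow> dist ((norm (p m))\<^sup>2) ((norm (p n))\<^sup>2) < e\<^sup>2"
        using metric_CauchyD[OF C, of "e\<^sup>2"] by auto
      have le: "dist (p m) (p n) < e" if "M \<le> m" "m \<le> n" for m n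
      proof -
        have "(norm (p m - p n))\<^sup>2 < e\<^sup>2" using mono[OF that(2)] M[of m n] that by (simp add: dist_norm)
        then show ?thesis using e by (simp add: dist_norm power_less_imp_less_base)
      qed
      have "dist (p m) (p n) < e" if "M \<le> m" "M \<le> n" for m n
        using le[of m n] le[of n m] that by (cases "m \<le> n") (simp_all add: dist_commute)
      then show "\<exists>M. \<forall>m\<ge>M. \<forall>n\<ge>M. dist (p m) (p n) < e" by blast
    qed
    then obtain q where q: "p \<longlonglongrightarrow> q" using Cauchy_convergent convergent_def by blast
    have lim: "(\<lambda>n. ((1 / real (Suc n)) *\<^sub>R (x + p n), p n)) \<longlonglongrightarrow> (0 *\<^sub>R (x + q), q)"
      by (intro tendsto_intros q LIMSEQ_Suc[OF lim_1_over_n])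
    have "((1 / real (Suc n)) *\<^sub>R (x + p n), p n) \<in> (\<lambda>x. (x, A x)) ` D" for n
      using in_D[of n] A_p[of n] real_vector.subspace_scale[OF subspace_D]
      by (intro image_eqI[where x = "(1 / real (Suc n)) *\<^sub>R (x + p n)"]) (simp_all add: A_scaleR)
    then have "(0 *\<^sub>R (x + q), q) \<in> (\<lambda>x. (x, A x)) ` D"
      by (rule closed_sequentially[OF closed_A _ lim])
    then have "q = A 0" by auto
    also have "A 0 = 0" using A_scaleR[of 0 0] real_vector.subspace_0[OF subspace_D] by simp
    finally have "(\<lambda>n. x + p n) \<longlonglongrightarrow> x" using tendsto_add[OF tendsto_const q, of x] by simp
    then show ?thesis unfolding closure_sequential
      using in_D by (intro exI[of _ "\<lambda>n. x + p n"]) simp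
  qed
  then show ?thesis by auto
qed

section \<open>Bounded Dirac nodes\<close>

lemma rc_re_of_real: "rc_re (of_real r :: 'k::rc_scalar) = r"
proof -
  have "(of_real (2 * rc_re (of_real r :: 'k)) :: 'k) = of_real (2 * r)"
    unfolding rc_add_conj[symmetric] by (simp add: rc_conj_of_real)
  then show ?thesis by (simp only: of_real_eq_iff)
qed

lemma bounded_opD:
  assumes "bounded_op H K T"
  shows "bounded_linear T" "T (scal H c x) = scal K c (T x)"
  using assms by (simp_all add: bounded_op_def Vector_Spaces.linear_def module_hom_def module_hom_axioms_def)

lemma bounded_opI:
  assumes "hilbert_space H" "hilbert_space K" "bounded_linear T" "\<And>c x. T (scal H c x) = scal K c (T x)"
  shows "bounded_op H K T"
proof -
  interpret H: hilbert H by unfold_locales fact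
  interpret K: hilbert K by unfold_locales fact
  interpret T: bounded_linear T by fact
  show ?thesis
    unfolding bounded_op_def using assms(3,4)
    by (auto intro!: Vector_Spaces.linear.intro module_hom.intro module_hom_axioms.intro
        H.vector_space_axioms K.vector_space_axioms H.module_axioms K.module_axioms simp: T.add)
qed

locale bounded_dirac_node = E: hilbert E + X: hilbert X
  for E :: "('k::rc_scalar, 'e::banach) inner_structure" and X :: "('k, 'x::banach) inner_structure" +
  fixes domA :: "'x set" and A :: "'x \<Rightarrow> 'x" and B :: "'e \<Rightarrow> 'x" and C :: "'x \<Rightarrow> 'e" and D :: "'e \<Rightarrow> 'e"
  assumes A: "linear_op X X domA A" and B: "bounded_op E X B" and C: "bounded_op X E C"
    and D: "bounded_op E E D"
    and dirac_node: "dirac_node E X E id (bounded_node domA A B C D)"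
begin

abbreviation S :: "('x, 'e, 'e) node" where
  "S \<equiv> bounded_node domA A B C D"

sublocale B: bounded_linear B by (rule bounded_opD(1)[OF B])
sublocale C: bounded_linear C by (rule bounded_opD(1)[OF C])
sublocale D: bounded_linear D by (rule bounded_opD(1)[OF D])

lemma subspace_domA: "X.subspace domA" "subspace domA"
  using A X.subspace_real by (auto simp: linear_op_def)

lemma
  shows A_add: "\<lbrakk>x \<in> domA; y \<in> domA\<rbrakk> \<Longrightarrow> A (x + y) = A x + A y"
    and A_scal: "x \<in> domA \<Longrightarrow> A (scal X c x) = scal X c (A x)"
  using A by (simp_all add: linear_op_def)

lemma A_scaleR: "x \<in> domA \<Longrightarrow> A (r *\<^sub>R x) = r *\<^sub>R A x"
  using A_scal[of x "of_real r"] by (simp add: X.scal_of_real)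

text \<open>Three choices of the pair are exploited: \<open>e = 0\<close> makes \<open>A\<close>
  dissipative, \<open>x = 0\<close> makes \<open>D\<close> accretive, and
  \<open>e = - (l I + D)^-1 C x\<close> makes \<open>A - B (l I + D)^-1 C\<close>
  dissipative.\<close>

lemma dissipation:
  assumes "x \<in> domA" shows "X.re_ip (A x + B e) x \<le> E.re_ip (C x + D e) e"
proof -
  have "dissipative (prod_space X E) (ndom S) (\<lambda>w. (AB S w, - CD S w))"
    using dirac_node by (simp add: dirac_node_def maximal_dissipative_def)
  then have "rc_re (ip X (A x + B e) x + ip E (- (C x + D e)) e) \<le> 0"
    using assms by (auto simp: dissipative_def prod_space_def bounded_node_def)
  then show ?thesis using E.re_ip_minus_left[of "C x + D e" e] by (simp add: rc_re_add X.re_ip_def E.re_ip_def)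
qed

lemma D_nonneg: "0 \<le> E.re_ip (D e) e"
  using dissipation[of 0 e] subspace_0[OF subspace_domA(2)] by (simp add: C.zero)

definition R :: "'k \<Rightarrow> 'e \<Rightarrow> 'e" where
  "R \<beta> = inv (\<lambda>e. scal E \<beta> e + D e)"

lemma
  assumes "0 < rc_re \<beta>"
  shows bij_\<beta>_D: "bij (\<lambda>e. scal E \<beta> e + D e)" and R_bounded_linear: "bounded_linear (R \<beta>)"
proof -
  have "bounded_linear (\<lambda>e. scal E \<beta> e + D e)"
    by (intro bounded_linear_add E.scal_bounded_linear D.bounded_linear_axioms)
  moreover have "rc_re \<beta> * (norm e)\<^sup>2 \<le> E.re_ip (scal E \<beta> e + D e) e" for e
    using D_nonneg[of e] by (simp add: E.re_ip_simps E.re_ip_scal_self)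
  ultimately show "bij (\<lambda>e. scal E \<beta> e + D e)" "bounded_linear (R \<beta>)"
    unfolding R_def by (intro E.coercive_bij[OF _ assms]; simp)+
qed

lemma
  assumes "0 < rc_re \<beta>"
  shows \<beta>_D_R: "scal E \<beta> (R \<beta> w) + D (R \<beta> w) = w"
    and R_\<beta>_D: "R \<beta> (scal E \<beta> e + D e) = e"
  using bij_\<beta>_D[OF assms] unfolding R_def
  by (simp_all add: bij_is_surj surj_f_inv_f[of "\<lambda>e. scal E \<beta> e + D e"] bij_is_inj inv_f_f[of "\<lambda>e. scal E \<beta> e + D e"])

lemma R_bounded_op:
  assumes "0 < rc_re \<beta>" shows "bounded_op E E (R \<beta>)"
proof (intro bounded_opI E.hilbert R_bounded_linear assms)
  fix c w
  have "scal E \<beta> (scal E c (R \<beta> w)) + D (scal E c (R \<beta> w)) = scal E c w"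
    using \<beta>_D_R[OF assms, of w, THEN arg_cong, of "scal E c"]
    by (simp add: bounded_opD[OF D] E.scale_right_distrib mult.commute)
  then show "R \<beta> (scal E c w) = scal E c (R \<beta> w)" using R_\<beta>_D[OF assms] by metis
qed

lemma A_m_dissipative: "m_dissipative domA A"
proof -
  interpret A: dissipative_on domA A
  proof
    fix x and h :: real assume "x \<in> domA" "0 < h"
    then show "norm x \<le> norm (x - h *\<^sub>R A x)"
      using dissipation[of x 0] by (intro X.norm_le_if_re_ip_nonpos) (simp_all add: B.zero)
  qed (auto simp: subspace_domA A_add A_scaleR)
  obtain l where l: "0 < l"
    "(\<lambda>h. l *\<^sub>R h - (AB S h, - CD S h)) ` ndom S = UNIV"
    using dirac_node by (auto simp: dirac_node_def maximal_dissipative_def)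
  define Q where "Q = R (of_real l)"
  have l': "0 < rc_re (of_real l :: 'k)" using l by (simp add: rc_re_of_real)
  have Q: "l *\<^sub>R Q w + D (Q w) = w" "Q (l *\<^sub>R e + D e) = e" for w e
    using \<beta>_D_R[OF l'] R_\<beta>_D[OF l'] by (simp_all add: E.scal_of_real Q_def)
  interpret Q: bounded_linear Q unfolding Q_def by (rule R_bounded_linear[OF l'])
  define K where "K = (\<lambda>x. B (Q (C x)))"
  have K: "bounded_linear K"
    unfolding K_def
    by (intro bounded_linear_compose[of B "\<lambda>x. Q (C x)"] bounded_linear_compose[of Q C]
        B.bounded_linear_axioms Q.bounded_linear_axioms C.bounded_linear_axioms)
  interpret K: bounded_linear K by (rule K)
  interpret A1: dissipative_on domA "\<lambda>x. A x - K x"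
  proof
    fix x and h :: real assume x: "x \<in> domA" "0 < h"
    \<comment> \<open>This is the solution of \<open>l e + C x + D e = 0\<close>; for it the
      right-hand side of the dissipation inequality is \<open>- l (norm e)^2\<close>.\<close>
    define e where "e = - Q (C x)"
    have "C x + D e = - (l *\<^sub>R e)" using Q(1)[of "C x"] by (simp add: e_def D.neg algebra_simps)
    then have "X.re_ip (A x - K x) x \<le> - (l * E.re_ip e e)"
      using dissipation[OF x(1), of e] E.re_ip_simps by (simp add: K_def e_def B.neg)
    also have "\<dots> \<le> 0" using l by (simp add: E.re_ip_self)
    finally show "norm x \<le> norm (x - h *\<^sub>R (A x - K x))"
      using x by (intro X.norm_le_if_re_ip_nonpos)
  qed (auto simp: subspace_domA A_add A_scaleR K.add K.scaleR algebra_simps)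
  have "(\<lambda>x. l *\<^sub>R x - (A x - K x)) ` domA = UNIV"
  proof -
    have "y \<in> (\<lambda>x. l *\<^sub>R x - (A x - K x)) ` domA" for y
    proof -
      \<comment> \<open>The zero second component forces \<open>e = - Q (C x)\<close>, so the first
        component becomes an equation for \<open>A - K\<close> alone.\<close>
      have "(y, 0) \<in> (\<lambda>h. l *\<^sub>R h - (AB S h, - CD S h)) ` ndom S" using l by simp
      then obtain x e where x: "x \<in> domA" "y = l *\<^sub>R x - (A x + B e)" and e: "l *\<^sub>R e + (C x + D e) = 0"
        by (auto simp: bounded_node_def)
      have "l *\<^sub>R e + D e = - C x" using e by (simp add: algebra_simps eq_neg_iff_add_eq_0)
      then have "e = - Q (C x)" using Q(2)[of e] by (simp add: Q.neg)
      then show ?thesis using x by (intro image_eqI[of _ _ x]) (simp_all add: K_def B.neg)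
    qed
    then show ?thesis by auto
  qed
  note A1_onto = A1.onto_all[OF l(1) this]
  obtain k where k: "0 < k" "\<And>x. norm (K x) \<le> norm x * k" using K.pos_bounded by blast
  \<comment> \<open>The parameter \<open>k + 1\<close> exceeds the bound \<open>k\<close> of
    \<open>K\<close>, so adding \<open>K\<close> back to \<open>A - K\<close> preserves
    surjectivity.\<close>
  have "(\<lambda>x. (k + 1) *\<^sub>R x - (A x - K x) - K x) ` domA = UNIV"
    using k by (intro A1.onto_bounded_perturbation[where k = k] A1_onto K) (simp_all add: mult.commute)
  then have "(\<lambda>x. (k + 1) *\<^sub>R x - A x) ` domA = UNIV" by simp
  then show ?thesis using k by (intro A.m_dissipativeI[of "k + 1"]) auto
qed

lemma A_dense_m_dissipative: "dense_m_dissipative domA A"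
proof -
  have "X.re_ip (A x) x \<le> 0" if "x \<in> domA" for x
    using dissipation[OF that, of 0] by (simp add: B.zero)
  then show ?thesis
    by (intro dense_m_dissipative.intro dense_m_dissipative_axioms.intro A_m_dissipative
        X.m_dissipative_dense[OF A_m_dissipative])
qed

lemma A_generates: "generates_C0_semigroup X domA A"
proof -
  interpret A: dense_m_dissipative domA A by (rule A_dense_m_dissipative)
  have "C0_semigroup X A.T"
    unfolding C0_semigroup_def
  proof (intro conjI allI impI A.T_0 A.T_add A.T_tendsto_0)
    fix t
    show "bounded_op X X (A.T t)"
      by (intro bounded_opI X.hilbert A.T_bounded_linear A.T_comm X.scal_bounded_linear)
        (auto simp: A_scal X.subspace_scale[OF subspace_domA(1)])
  qed
  then show ?thesis unfolding generates_C0_semigroup_def using A.T_derivative_iff by blast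
qed

lemma system_node: "system_node E X E S"
proof -
  interpret A: dense_m_dissipative domA A by (rule A_dense_m_dissipative)
  let ?G = "(\<lambda>x. (x, A x)) ` domA"
  have G: "(x, z) \<in> ?G \<longleftrightarrow> x \<in> domA \<and> z = A x" for x z by auto
  have cAB: "closed ((\<lambda>w. (w, AB S w)) ` ndom S)"
  proof -
    \<comment> \<open>Subtracting the bounded part \<open>B e\<close> reduces the graph to that of
      \<open>A\<close>, which is closed.\<close>
    have eq: "(\<lambda>w. (w, AB S w)) ` ndom S = (\<lambda>p. (fst (fst p), snd p - B (snd (fst p)))) -` ?G"
      by (auto simp: bounded_node_def G algebra_simps image_iff)
    show ?thesis
      unfolding eq by (intro closed_vimage A.closed_A continuous_intros B.continuous_on)
  qed
  have cABCD: "closed ((\<lambda>w. (w, AB S w, CD S w)) ` ndom S)"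
  proof -
    have "(\<lambda>w. (w, AB S w, CD S w)) ` ndom S =
        (\<lambda>p. (fst p, fst (snd p))) -` ((\<lambda>w. (w, AB S w)) ` ndom S)
        \<inter> {p. snd (snd p) = C (fst (fst p)) + D (snd (fst p))}"
      by (auto simp: bounded_node_def image_iff)
    moreover have "closed ((\<lambda>p::('x \<times> 'e) \<times> 'x \<times> 'e. (fst p, fst (snd p))) -` ((\<lambda>w. (w, AB S w)) ` ndom S))"
      by (rule closed_vimage[OF cAB]) (intro continuous_intros)
    moreover have "closed {p::('x \<times> 'e) \<times> 'x \<times> 'e. snd (snd p) = C (fst (fst p)) + D (snd (fst p))}"
      by (intro closed_Collect_eq continuous_intros C.continuous_on D.continuous_on)
    ultimately show ?thesis by (simp only: closed_Int)
  qed
  have "linear_op (prod_space X E) (prod_space X E) (ndom S) (\<lambda>w. (AB S w, CD S w))"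
    using dirac_node by (simp add: dirac_node_def)
  moreover have "{x. (x, 0) \<in> ndom S} = domA" "(\<lambda>x. AB S (x, 0)) = A"
    by (auto simp: bounded_node_def B.zero)
  moreover have "\<exists>x. (x, e) \<in> ndom S" for e
    using subspace_0[OF subspace_domA(2)] by (auto simp: bounded_node_def)
  ultimately show ?thesis
    unfolding system_node_def closed_op_def using cAB cABCD A_generates by simp
qed

end

section \<open>Locally square integrable functions\<close>

lemma square_norm_borel_measurable:
  assumes "u measurable_on {0::real..}"
  shows "(\<lambda>t. (norm (u t))\<^sup>2) \<in> borel_measurable (lebesgue_on {0..\<tau>})"
proof -
  have "(\<lambda>x. (norm x)\<^sup>2) \<circ> u measurable_on {0..}"
    by (rule measurable_on_compose_continuous_0[OF assms]) (auto intro!: continuous_intros)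
  then have "(\<lambda>x. (norm x)\<^sup>2) \<circ> u \<in> borel_measurable (lebesgue_on {0..})"
    by (rule measurable_on_imp_borel_measurable_lebesgue) simp
  then show ?thesis
    unfolding o_def by (rule measurable_restrict_mono) auto
qed

lemma L2_locI:
  assumes "u measurable_on {0..}"
    and "\<And>\<tau>. 0 \<le> \<tau> \<Longrightarrow> g \<tau> integrable_on {0..\<tau>}"
    and "\<And>\<tau> t. 0 \<le> t \<Longrightarrow> t \<le> \<tau> \<Longrightarrow> (norm (u t))\<^sup>2 \<le> g \<tau> t"
  shows "u \<in> L2_loc"
proof -
  have "(\<lambda>t. (norm (u t))\<^sup>2) integrable_on {0..\<tau>}" if "0 \<le> \<tau>" for \<tau>
    by (rule measurable_bounded_by_integrable_imp_integrable_real
        [OF square_norm_borel_measurable[OF assms(1)] assms(2)[OF that]])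
      (use assms(3) in auto)
  then show ?thesis using assms(1) by (simp add: L2_loc_def)
qed

lemma L2_loc_add:
  assumes "u \<in> L2_loc" "v \<in> L2_loc" shows "(\<lambda>t. u t + v t) \<in> L2_loc"
proof (rule L2_locI)
  show "(\<lambda>t. u t + v t) measurable_on {0..}"
    using assms by (intro measurable_on_add) (simp_all add: L2_loc_def)
  show "(\<lambda>t. 2 * (norm (u t))\<^sup>2 + 2 * (norm (v t))\<^sup>2) integrable_on {0..\<tau>}" if "0 \<le> \<tau>" for \<tau>
    using assms that by (intro integrable_add integrable_on_mult_right) (auto simp: L2_loc_def)
  show "(norm (u t + v t))\<^sup>2 \<le> 2 * (norm (u t))\<^sup>2 + 2 * (norm (v t))\<^sup>2" for t
  proof -
    have "(norm (u t + v t))\<^sup>2 \<le> (norm (u t) + norm (v t))\<^sup>2"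
      by (intro power_mono norm_triangle_ineq) simp
    also have "\<dots> \<le> 2 * (norm (u t))\<^sup>2 + 2 * (norm (v t))\<^sup>2"
      using zero_le_power2[of "norm (u t) - norm (v t)"] by (simp add: power2_eq_square algebra_simps)
    finally show ?thesis .
  qed
qed

lemma L2_loc_bounded_linear:
  assumes "bounded_linear L" "u \<in> L2_loc" shows "(\<lambda>t. L (u t)) \<in> L2_loc"
proof -
  interpret L: bounded_linear L by fact
  obtain M where M: "\<And>x. norm (L x) \<le> norm x * M" using L.bounded by blast
  show ?thesis
  proof (rule L2_locI)
    have "L \<circ> u measurable_on {0..}"
      using assms(2) by (intro measurable_on_compose_continuous_0 L.continuous_on continuous_on_id)
        (simp_all add: L2_loc_def L.zero)
    then show "(\<lambda>t. L (u t)) measurable_on {0..}" by (simp add: o_def)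
    show "(\<lambda>t. (norm (u t))\<^sup>2 * M\<^sup>2) integrable_on {0..\<tau>}" if "0 \<le> \<tau>" for \<tau>
      using assms that by (intro integrable_on_mult_left) (auto simp: L2_loc_def)
    show "(norm (L (u t)))\<^sup>2 \<le> (norm (u t))\<^sup>2 * M\<^sup>2" for t
      using power_mono[OF M[of "u t"], of 2] by (simp add: power_mult_distrib)
  qed
qed

lemma H1_loc_add:
  assumes "u \<in> H1_loc" "v \<in> H1_loc" shows "(\<lambda>t. u t + v t) \<in> H1_loc"
proof -
  obtain g h where g: "g \<in> L2_loc" "\<And>t. 0 \<le> t \<Longrightarrow> (g has_integral (u t - u 0)) {0..t}"
    and h: "h \<in> L2_loc" "\<And>t. 0 \<le> t \<Longrightarrow> (h has_integral (v t - v 0)) {0..t}"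
    using assms by (auto simp: H1_loc_def)
  have "((\<lambda>t. g t + h t) has_integral ((u t + v t) - (u 0 + v 0))) {0..t}" if "0 \<le> t" for t
    using has_integral_add[OF g(2)[OF that] h(2)[OF that]] by (simp add: algebra_simps)
  then show ?thesis using L2_loc_add[OF g(1) h(1)] by (auto simp: H1_loc_def)
qed

lemma H1_loc_bounded_linear:
  assumes "bounded_linear L" "u \<in> H1_loc" shows "(\<lambda>t. L (u t)) \<in> H1_loc"
proof -
  obtain g where g: "g \<in> L2_loc" "\<And>t. 0 \<le> t \<Longrightarrow> (g has_integral (u t - u 0)) {0..t}"
    using assms by (auto simp: H1_loc_def)
  have "((\<lambda>t. L (g t)) has_integral (L (u t) - L (u 0))) {0..t}" if "0 \<le> t" for t
    using has_integral_linear[OF g(2)[OF that] assms(1)]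
    by (simp add: o_def linear_diff[OF bounded_linear.linear[OF assms(1)]])
  then show ?thesis using L2_loc_bounded_linear[OF assms(1) g(1)] by (auto simp: H1_loc_def)
qed

lemma H1_loc_diff:
  assumes "u \<in> H1_loc" "v \<in> H1_loc" shows "(\<lambda>t. u t - v t) \<in> H1_loc"
  using H1_loc_add[OF assms(1) H1_loc_bounded_linear[OF bounded_linear_minus[OF bounded_linear_ident] assms(2)]]
  by simp

lemma H1_loc_cong: "(\<And>t. 0 \<le> t \<Longrightarrow> u t = v t) \<Longrightarrow> u \<in> H1_loc \<longleftrightarrow> v \<in> H1_loc"
  by (simp add: H1_loc_def)

lemma H1_loc_subset_L2_loc: "H1_loc \<subseteq> L2_loc"
proof
  fix u :: "real \<Rightarrow> 'a" assume "u \<in> H1_loc"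
  then obtain g where g: "\<And>t. 0 \<le> t \<Longrightarrow> (g has_integral (u t - u 0)) {0..t}"
    by (auto simp: H1_loc_def)
  have u_eq: "u t = u 0 + integral {0..t} g" if "0 \<le> t" for t
    using integral_unique[OF g[OF that]] by simp
  have cont: "continuous_on {0..\<tau>} u" if "0 \<le> \<tau>" for \<tau>
  proof -
    have "continuous_on {0..\<tau>} (\<lambda>t. u 0 + integral {0..t} g)"
      by (rule continuous_on_add[OF continuous_on_const
            indefinite_integral_continuous_1[OF has_integral_integrable[OF g[OF that]]]])
    then show ?thesis by (rule continuous_on_eq) (simp flip: u_eq)
  qed
  have "continuous_on {0..} u"
    unfolding continuous_on_eq_continuous_within
  proof
    fix t :: real assume t: "t \<in> {0..}"
    then have "continuous (at t within {0..t + 1}) u"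
      using cont[of "t + 1"] by (auto simp: continuous_on_eq_continuous_within)
    moreover have "at t within {0..} = at t within {0..t + 1}"
      by (rule at_within_nhd[of _ "{..<t + 1}"]) auto
    ultimately show "continuous (at t within {0..}) u" by simp
  qed
  \<comment> \<open>Freezing the value at 0 for negative times gives a continuous function on the
    whole line, from which measurability on the half-line follows.\<close>
  then have "continuous_on UNIV (\<lambda>t. u (max 0 t))"
    by (rule continuous_on_compose2) (auto intro!: continuous_intros)
  then have "(\<lambda>t. if t \<in> {0..} then u (max 0 t) else 0) measurable_on UNIV"
    by (intro measurable_on_restrict continuous_imp_measurable_on) auto
  also have "(\<lambda>t. if t \<in> {0..} then u (max 0 t) else 0) = (\<lambda>t. if t \<in> {0..} then u t else 0)"
    by (auto simp: max_def)
  finally have "u measurable_on {0..}" by (simp only: measurable_on_UNIV)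
  then show "u \<in> L2_loc"
    by (auto simp: L2_loc_def intro!: integrable_continuous_real continuous_intros cont)
qed

section \<open>Almost everywhere equality\<close>

lemma ae_eq_iff: "ae_eq u v \<longleftrightarrow> (AE t in lebesgue. 0 \<le> t \<longrightarrow> u t = v t)"
  by (simp add: ae_eq_def AE_restrict_space_iff)

lemma ae_eq_negligible: "ae_eq u v \<longleftrightarrow> negligible {t. 0 \<le> t \<and> u t \<noteq> v t}"
proof -
  have "ae_eq u v \<longleftrightarrow> {t. \<not> (0 \<le> t \<longrightarrow> u t = v t)} \<in> null_sets lebesgue"
    unfolding ae_eq_iff by (subst completion.AE_iff_null_sets) auto
  also have "{t. \<not> (0 \<le> t \<longrightarrow> u t = v t)} = {t. 0 \<le> t \<and> u t \<noteq> v t}" by auto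
  finally show ?thesis by (simp add: negligible_iff_null_sets)
qed

lemma ae_class_eq_iff: "ae_class u = ae_class v \<longleftrightarrow> ae_eq u v"
proof
  assume "ae_class u = ae_class v"
  moreover have "v \<in> ae_class v" by (simp add: ae_class_def ae_eq_iff)
  ultimately show "ae_eq u v" unfolding ae_class_def by blast
next
  assume "ae_eq u v"
  then have "ae_eq u w \<longleftrightarrow> ae_eq v w" for w unfolding ae_eq_iff by (auto elim: AE_mp)
  then show "ae_class u = ae_class v" by (simp add: ae_class_def)
qed

text \<open>Membership of \<open>w\<close> in \<open>L2_loc\<close> supplies integrability, without
  which a zero value of \<open>integral\<close> carries no information, as it is also the default
  value.\<close>

lemma integral_square_norm_eq_0_iff:
  assumes "w \<in> L2_loc"
  shows "(\<forall>\<tau>\<ge>0. integral {0..\<tau>} (\<lambda>s. (norm (w s))\<^sup>2) = 0) \<longleftrightarrow> ae_eq w (\<lambda>s. 0)"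
proof
  assume zero: "\<forall>\<tau>\<ge>0. integral {0..\<tau>} (\<lambda>s. (norm (w s))\<^sup>2) = 0"
  have "AE s in lebesgue. s \<in> {0..real n} \<longrightarrow> w s = 0" for n
  proof -
    have int: "(\<lambda>s. (norm (w s))\<^sup>2) integrable_on {0..real n}" using assms by (simp add: L2_loc_def)
    then have "(\<lambda>s. (norm (w s))\<^sup>2) absolutely_integrable_on {0..real n}"
      by (intro nonnegative_absolutely_integrable_1) auto
    then have li: "integrable (lebesgue_on {0..real n}) (\<lambda>s. (norm (w s))\<^sup>2)"
      by (simp add: absolutely_integrable_imp_integrable)
    then have "integral\<^sup>L (lebesgue_on {0..real n}) (\<lambda>s. (norm (w s))\<^sup>2) = 0"
      using zero by (simp add: lebesgue_integral_eq_integral)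
    then have "AE s in lebesgue_on {0..real n}. (norm (w s))\<^sup>2 = 0"
      using integral_nonneg_eq_0_iff_AE[OF li] by simp
    then show ?thesis by (simp add: AE_restrict_space_iff)
  qed
  then have "AE s in lebesgue. \<forall>n. s \<in> {0..real n} \<longrightarrow> w s = 0" unfolding AE_all_countable by blast
  then show "ae_eq w (\<lambda>s. 0)"
    unfolding ae_eq_iff by eventually_elim (use real_arch_simple in auto)
next
  assume "ae_eq w (\<lambda>s. 0)"
  then have N: "negligible {t. 0 \<le> t \<and> w t \<noteq> 0}" by (simp add: ae_eq_negligible)
  have "integral {0..\<tau>} (\<lambda>s. (norm (w s))\<^sup>2) = integral {0..\<tau>} (\<lambda>s. 0)" for \<tau>
    by (rule integral_spike[OF N]) auto
  then show "\<forall>\<tau>\<ge>0. integral {0..\<tau>} (\<lambda>s. (norm (w s))\<^sup>2) = 0" by simp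
qed

lemma C2_fun_subset_C1_fun: "C2_fun \<subseteq> C1_fun"
proof
  fix u :: "real \<Rightarrow> 'a" assume "u \<in> C2_fun"
  then obtain u' u'' where u: "\<And>t. 0 \<le> t \<Longrightarrow> (u has_vector_derivative u' t) (at t within {0..})"
      "\<And>t. 0 \<le> t \<Longrightarrow> (u' has_vector_derivative u'' t) (at t within {0..})"
    by (auto simp: C2_fun_def C1_fun_def)
  then have "continuous_on {0..} u'"
    by (intro continuous_on_vector_derivative) auto
  then show "u \<in> C1_fun" using u(1) by (auto simp: C1_fun_def)
qed

lemma C1_fun_add:
  assumes "u \<in> C1_fun" "v \<in> C1_fun" shows "(\<lambda>t. u t + v t) \<in> C1_fun"
proof -
  obtain u' v' where "continuous_on {0..} u'" "continuous_on {0..} v'"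
      "\<And>t. 0 \<le> t \<Longrightarrow> (u has_vector_derivative u' t) (at t within {0..})"
      "\<And>t. 0 \<le> t \<Longrightarrow> (v has_vector_derivative v' t) (at t within {0..})"
    using assms by (auto simp: C1_fun_def)
  then show ?thesis
    unfolding C1_fun_def
    by (intro CollectI exI[of _ "\<lambda>t. u' t + v' t"]) (auto intro!: continuous_intros has_vector_derivative_add)
qed

lemma C1_fun_bounded_linear:
  assumes "bounded_linear L" "u \<in> C1_fun" shows "(\<lambda>t. L (u t)) \<in> C1_fun"
proof -
  obtain u' where "continuous_on {0..} u'"
      "\<And>t. 0 \<le> t \<Longrightarrow> (u has_vector_derivative u' t) (at t within {0..})"
    using assms by (auto simp: C1_fun_def)
  then show ?thesis
    unfolding C1_fun_def
    by (intro CollectI exI[of _ "\<lambda>t. L (u' t)"])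
      (auto intro!: bounded_linear.continuous_on[OF assms(1)] bounded_linear.has_vector_derivative[OF assms(1)])
qed

text \<open>
  The truncated outputs in \<open>V_limit\<close> agree almost everywhere with \<open>u + y\<close> on \<open>{0..\<tau>}\<close> as soon as
  \<open>t \<ge> \<tau>\<close>, so the limit is attained at finite times.
\<close>

lemma tendsto_L2_loc_mild_solution_iff:
  assumes mild: "mild_solution \<Sigma> x0 u x y" and v: "v \<in> L2_loc"
  shows "tendsto_L2_loc (\<lambda>t s. obsv \<Sigma> t 0 x0 s + u s + inout \<Sigma> t 0 (trunc 0 t u) s) v \<longleftrightarrow>
    ae_eq v (\<lambda>s. u s + y s)"
proof -
  define w where "w s = u s + y s - v s" for s
  have w: "w \<in> L2_loc"
    using L2_loc_add[OF L2_loc_add[of u y] L2_loc_bounded_linear[OF bounded_linear_minus[OF bounded_linear_ident] v]]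
      mild by (simp add: mild_solution_def w_def[abs_def])
  define I where "I t \<tau> = integral {0..\<tau>}
    (\<lambda>s. (norm (obsv \<Sigma> t 0 x0 s + u s + inout \<Sigma> t 0 (trunc 0 t u) s - v s))\<^sup>2)" for t \<tau>
  have I: "I t \<tau> = integral {0..\<tau>} (\<lambda>s. (norm (w s))\<^sup>2)" if "0 \<le> \<tau>" "\<tau> \<le> t" for t \<tau>
  proof -
    have "ae_eq (trunc 0 t y) (\<lambda>s. obsv \<Sigma> t 0 x0 s + inout \<Sigma> t 0 (trunc 0 t u) s)"
      using mild that by (simp add: mild_solution_def)
    then have "negligible {s. 0 \<le> s \<and> trunc 0 t y s \<noteq> obsv \<Sigma> t 0 x0 s + inout \<Sigma> t 0 (trunc 0 t u) s}"
      by (simp add: ae_eq_negligible)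
    then show ?thesis
      unfolding I_def
      by (rule integral_spike) (use that in \<open>auto simp: w_def trunc_def indicator_def algebra_simps\<close>)
  qed
  have "((\<lambda>t. I t \<tau>) \<longlongrightarrow> 0) at_top \<longleftrightarrow> integral {0..\<tau>} (\<lambda>s. (norm (w s))\<^sup>2) = 0" if "0 \<le> \<tau>" for \<tau>
  proof -
    have "eventually (\<lambda>t. I t \<tau> = integral {0..\<tau>} (\<lambda>s. (norm (w s))\<^sup>2)) at_top"
      using eventually_ge_at_top[of \<tau>] by eventually_elim (simp add: I that)
    then show ?thesis by (simp add: tendsto_cong tendsto_const_iff)
  qed
  then have "tendsto_L2_loc (\<lambda>t s. obsv \<Sigma> t 0 x0 s + u s + inout \<Sigma> t 0 (trunc 0 t u) s) v \<longleftrightarrow> ae_eq w (\<lambda>s. 0)"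
    by (simp add: tendsto_L2_loc_def I_def integral_square_norm_eq_0_iff[OF w, symmetric])
  also have "\<dots> \<longleftrightarrow> ae_eq v (\<lambda>s. u s + y s)"
    unfolding ae_eq_iff w_def by (intro arg_cong[of _ _ "\<lambda>P. eventually P _"]) (auto simp: fun_eq_iff)
  finally show ?thesis .
qed

section \<open>Classical solutions\<close>

context bounded_dirac_node
begin

lemma ndom_S: "ndom S = domA \<times> UNIV"
  by (simp add: bounded_node_def)

lemma AB_S: "AB S (x, e) = A x + B e" and CD_S: "CD S (x, e) = C x + D e"
  by (simp_all add: bounded_node_def)

section \<open>External Cayley transform of a bounded node\<close>

context
  fixes \<beta> :: 'k and \<gamma> :: real
  assumes \<beta>: "0 < rc_re \<beta>" and \<gamma>_eq: "\<gamma> = sqrt (2 * rc_re \<beta>)"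
begin

abbreviation S_cross :: "('x, 'e, 'e) node" where
  "S_cross \<equiv> cayley_transform E id \<beta> S"

lemma \<gamma>: "0 < \<gamma>" "\<gamma> * \<gamma> = 2 * rc_re \<beta>" "\<gamma> \<noteq> 0"
  using \<beta> by (simp_all add: \<gamma>_eq)

lemma \<beta>_conj_add: "scal E \<beta> e + scal E (rc_conj \<beta>) e = \<gamma> *\<^sub>R \<gamma> *\<^sub>R e"
  using E.scal_of_real[of "\<gamma> * \<gamma>" e] E.scale_left_distrib[of \<beta> "rc_conj \<beta>" e] rc_add_conj[of \<beta>] \<gamma>(2)
  by simp

lemma cayley_map_eq: "cayley_map E id \<beta> S (x, e) = (\<gamma> *\<^sub>R x, scal E \<beta> e + (C x + D e))"
  by (simp add: cayley_map_def CD_S \<gamma>_eq)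

lemma inj_cayley_map: "inj (cayley_map E id \<beta> S)"
proof (rule injI, clarify)
  fix x x' e e' assume eq: "cayley_map E id \<beta> S (x, e) = cayley_map E id \<beta> S (x', e')"
  then have "x = x'" using \<gamma>(3) by (simp add: cayley_map_eq)
  then have "scal E \<beta> e + D e = scal E \<beta> e' + D e'"
    using eq unfolding cayley_map_eq by (simp add: add.left_commute)
  then show "x = x' \<and> e = e'" using R_\<beta>_D[OF \<beta>] \<open>x = x'\<close> by metis
qed

text \<open>Every \<open>u\<close> is reached because \<open>\<beta> I + D\<close> is onto: the
  effort \<open>R \<beta> (u - C x)\<close> does it. The factor \<open>1 / \<gamma>\<close> undoes
  the scaling of the state in the Cayley map.\<close>

lemma ndom_S_cross: "ndom S_cross = domA \<times> UNIV"
proof -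
  have "(x, u) \<in> cayley_map E id \<beta> S ` ndom S" if x: "x \<in> domA" for x u
  proof (rule image_eqI)
    let ?x = "(1 / \<gamma>) *\<^sub>R x"
    show "(x, u) = cayley_map E id \<beta> S (?x, R \<beta> (u - C ?x))"
      using \<beta>_D_R[OF \<beta>, of "u - C ?x"] \<gamma>(3) unfolding cayley_map_eq
      by (simp add: algebra_simps)
    show "(?x, R \<beta> (u - C ?x)) \<in> ndom S"
      using x by (simp add: ndom_S subspace_scale[OF subspace_domA(2)])
  qed
  moreover have "cayley_map E id \<beta> S ` ndom S \<subseteq> domA \<times> UNIV"
    by (auto simp: ndom_S cayley_map_eq subspace_scale[OF subspace_domA(2)])
  ultimately show ?thesis by (auto simp: cayley_transform_def Let_def)
qed

text \<open>The inverse inside the transform is avoided by exhibiting the preimage: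
  \<open>(x, u)\<close> is the image of \<open>(x, e)\<close> scaled by \<open>1 / \<gamma>\<close>.
  Linearity then cancels the factors of \<open>\<gamma>\<close>.\<close>

lemma S_cross_values:
  assumes x: "x \<in> domA" and u: "\<gamma> *\<^sub>R u = scal E \<beta> e + (C x + D e)"
  shows "AB S_cross (x, u) = A x + B e" "\<gamma> *\<^sub>R CD S_cross (x, u) = scal E (rc_conj \<beta>) e - (C x + D e)"
proof -
  define r where "r = 1 / \<gamma>"
  have r: "\<gamma> *\<^sub>R r *\<^sub>R z = z" "r *\<^sub>R \<gamma> *\<^sub>R z = z" for z :: "'a::real_vector"
    using \<gamma>(3) by (simp_all add: r_def)
  interpret sb: bounded_linear "scal E c" for c by (rule E.scal_bounded_linear)
  have "cayley_map E id \<beta> S (r *\<^sub>R x, r *\<^sub>R e) = (x, r *\<^sub>R (\<gamma> *\<^sub>R u))"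
    unfolding cayley_map_eq u r by (simp add: sb.scaleR C.scaleR D.scaleR scaleR_add_right)
  then have "cayley_map E id \<beta> S (r *\<^sub>R x, r *\<^sub>R e) = (x, u)" by (simp only: r)
  moreover have "(r *\<^sub>R x, r *\<^sub>R e) \<in> ndom S" using x by (simp add: ndom_S subspace_scale[OF subspace_domA(2)])
  ultimately have "inv_into (ndom S) (cayley_map E id \<beta> S) (x, u) = (r *\<^sub>R x, r *\<^sub>R e)"
    using inj_on_subset[OF inj_cayley_map] by (intro inv_into_f_eq) auto
  then have "AB S_cross (x, u) = \<gamma> *\<^sub>R r *\<^sub>R (A x + B e)"
    "CD S_cross (x, u) = r *\<^sub>R (scal E (rc_conj \<beta>) e - (C x + D e))"
    using x by (simp_all only: cayley_transform_def Let_def \<gamma>_eq[symmetric] node.simps AB_S CD_S A_scaleR B.scaleR C.scaleR D.scaleR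
        scaleR_add_right scaleR_diff_right snd_conv id_apply sb.scaleR)
  then show "AB S_cross (x, u) = A x + B e" "\<gamma> *\<^sub>R CD S_cross (x, u) = scal E (rc_conj \<beta>) e - (C x + D e)"
    by (simp_all only: r)
qed

text \<open>For the converse, let \<open>e'\<close> be the effort that \<open>x\<close> and
  \<open>u\<close> determine. The sum of input and output is \<open>\<gamma> e\<close> by hypothesis
  and \<open>\<gamma> e'\<close> by the transform, so the efforts agree, and the input equation then
  yields \<open>f\<close>.\<close>

lemma S_cross_output_iff:
  assumes x: "x \<in> domA" and u: "\<gamma> *\<^sub>R u = scal E \<beta> e + f" and y: "\<gamma> *\<^sub>R y = scal E (rc_conj \<beta>) e - f"
  shows "y = CD S_cross (x, u) \<longleftrightarrow> f = C x + D e"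
proof
  assume "f = C x + D e"
  then have "\<gamma> *\<^sub>R CD S_cross (x, u) = \<gamma> *\<^sub>R y" using S_cross_values(2)[OF x, of u e] u y by simp
  then show "y = CD S_cross (x, u)" using \<gamma>(3) by simp
next
  assume y': "y = CD S_cross (x, u)"
  define e' where "e' = R \<beta> (\<gamma> *\<^sub>R u - C x)"
  have u': "\<gamma> *\<^sub>R u = scal E \<beta> e' + (C x + D e')"
    using \<beta>_D_R[OF \<beta>, of "\<gamma> *\<^sub>R u - C x"] by (simp add: e'_def algebra_simps)
  have "\<gamma> *\<^sub>R u + \<gamma> *\<^sub>R y = \<gamma> *\<^sub>R \<gamma> *\<^sub>R e"
    unfolding u y \<beta>_conj_add[symmetric] by simp
  moreover have "\<gamma> *\<^sub>R u + \<gamma> *\<^sub>R y = \<gamma> *\<^sub>R \<gamma> *\<^sub>R e'"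
    unfolding y' S_cross_values(2)[OF x u'] unfolding u' \<beta>_conj_add[symmetric] by simp
  ultimately have "e = e'" using \<gamma>(3) by simp
  then show "f = C x + D e" using u u' by simp
qed

text \<open>The change between \<open>(e, f)\<close> and \<open>(u, y)\<close> is bounded, linear
  and invertible, hence preserves \<open>H1_loc\<close> both ways; the state and output equations
  correspond at each time separately.\<close>

lemma classical_solution_cayley_iff:
  assumes u: "\<And>t. 0 \<le> t \<Longrightarrow> \<gamma> *\<^sub>R u t = scal E \<beta> (e t) + f t"
    and y: "\<And>t. 0 \<le> t \<Longrightarrow> \<gamma> *\<^sub>R y t = scal E (rc_conj \<beta>) (e t) - f t"
  shows "classical_solution S_cross P G u x y \<longleftrightarrow> classical_solution S P G e x f"
proof -
  have H1: "(u \<in> H1_loc \<and> y \<in> H1_loc) \<longleftrightarrow> (e \<in> H1_loc \<and> f \<in> H1_loc)"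
  proof safe
    assume uy: "u \<in> H1_loc" "y \<in> H1_loc"
    have "(1 / \<gamma>) *\<^sub>R (u t + y t) = e t" if "0 \<le> t" for t
    proof -
      have "\<gamma> *\<^sub>R (u t + y t) = \<gamma> *\<^sub>R \<gamma> *\<^sub>R e t"
        using u[OF that] y[OF that] \<beta>_conj_add[of "e t"] by (simp only: scaleR_add_right) simp
      then have "u t + y t = \<gamma> *\<^sub>R e t" using \<gamma>(3) unfolding scaleR_cancel_left by simp
      then show ?thesis using \<gamma>(3) by simp
    qed
    moreover have "(\<lambda>t. (1 / \<gamma>) *\<^sub>R (u t + y t)) \<in> H1_loc"
      by (intro H1_loc_bounded_linear[OF bounded_linear_scaleR_right] H1_loc_add uy)
    ultimately show e: "e \<in> H1_loc"
      using H1_loc_cong[of "\<lambda>t. (1 / \<gamma>) *\<^sub>R (u t + y t)" e] by blast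
    have "(\<lambda>t. \<gamma> *\<^sub>R u t - scal E \<beta> (e t)) \<in> H1_loc"
      by (intro H1_loc_diff H1_loc_bounded_linear[OF bounded_linear_scaleR_right]
          H1_loc_bounded_linear[OF E.scal_bounded_linear] uy e)
    then show "f \<in> H1_loc" using H1_loc_cong[of f "\<lambda>t. \<gamma> *\<^sub>R u t - scal E \<beta> (e t)"] u by simp
  next
    assume ef: "e \<in> H1_loc" "f \<in> H1_loc"
    have ru: "u t = (1 / \<gamma>) *\<^sub>R (scal E \<beta> (e t) + f t)" if "0 \<le> t" for t
      unfolding u[OF that, symmetric] using \<gamma>(3) by simp
    have ry: "y t = (1 / \<gamma>) *\<^sub>R (scal E (rc_conj \<beta>) (e t) - f t)" if "0 \<le> t" for t
      unfolding y[OF that, symmetric] using \<gamma>(3) by simp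
    have "(\<lambda>t. (1 / \<gamma>) *\<^sub>R (scal E \<beta> (e t) + f t)) \<in> H1_loc"
      by (intro H1_loc_bounded_linear[OF bounded_linear_scaleR_right] H1_loc_add
          H1_loc_bounded_linear[OF E.scal_bounded_linear] ef)
    then show "u \<in> H1_loc" by (simp add: H1_loc_cong[OF ru])
    have "(\<lambda>t. (1 / \<gamma>) *\<^sub>R (scal E (rc_conj \<beta>) (e t) - f t)) \<in> H1_loc"
      by (intro H1_loc_bounded_linear[OF bounded_linear_scaleR_right] H1_loc_diff
          H1_loc_bounded_linear[OF E.scal_bounded_linear] ef)
    then show "y \<in> H1_loc" by (simp add: H1_loc_cong[OF ry])
  qed
  have "(P t (x t), u t) \<in> ndom S_cross \<and>
        (x has_vector_derivative (AB S_cross (P t (x t), u t) + G t (inv (P t) (P t (x t))))) (at t within {0..}) \<and>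
        y t = CD S_cross (P t (x t), u t) \<longleftrightarrow>
        (P t (x t), e t) \<in> ndom S \<and>
        (x has_vector_derivative (AB S (P t (x t), e t) + G t (inv (P t) (P t (x t))))) (at t within {0..}) \<and>
        f t = CD S (P t (x t), e t)" if t: "0 \<le> t" for t
  proof (cases "P t (x t) \<in> domA")
    case True
    have "AB S_cross (P t (x t), u t) = A (P t (x t)) + B (e t)" if "f t = C (P t (x t)) + D (e t)"
      using S_cross_values(1)[OF True, of "u t" "e t"] u[OF t] that by simp
    then show ?thesis
      unfolding S_cross_output_iff[OF True u[OF t] y[OF t]] AB_S CD_S using True
      by (metis (no_types, lifting) SigmaI UNIV_I ndom_S ndom_S_cross)
  qed (simp add: ndom_S ndom_S_cross)
  with H1 show ?thesis unfolding classical_solution_def by blast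
qed

end

text \<open>Along a solution \<open>f - D e = C P x\<close>, so the new effort is
  \<open>e - K C P x\<close>, and the lost term \<open>B K C P x\<close> is returned by
  \<open>G'\<close>. Writing it as \<open>f - D e\<close> makes its \<open>H1_loc\<close> regularity
  immediate, without differentiating \<open>P(t) x(t)\<close>.\<close>

lemma classical_solution_feedback:
  assumes K: "bounded_linear K" and sol: "classical_solution S P G e x f"
    and bij: "\<And>t. 0 \<le> t \<Longrightarrow> bij (P t)"
    and G': "\<And>t z. 0 \<le> t \<Longrightarrow> G' t z = G t z + B (K (C (P t z)))"
  shows "classical_solution S P G' (\<lambda>t. e t - K (f t - D (e t))) x (\<lambda>t. f t - D (K (f t - D (e t))))"
proof -
  have H1: "e \<in> H1_loc" "f \<in> H1_loc" using sol by (simp_all add: classical_solution_def)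
  have DK: "(\<lambda>t. K (f t - D (e t))) \<in> H1_loc"
    by (intro H1_loc_bounded_linear[OF K] H1_loc_diff H1_loc_bounded_linear[OF D.bounded_linear_axioms] H1)
  show ?thesis
    unfolding classical_solution_def
  proof (intro conjI allI impI)
    show "(\<lambda>t. e t - K (f t - D (e t))) \<in> H1_loc" "(\<lambda>t. f t - D (K (f t - D (e t)))) \<in> H1_loc"
      by (intro H1_loc_diff H1 DK H1_loc_bounded_linear[OF D.bounded_linear_axioms DK])+
    show "x \<in> C1_fun" using sol by (simp add: classical_solution_def)
    fix t :: real assume t: "0 \<le> t"
    have dom: "P t (x t) \<in> domA" and f: "f t = C (P t (x t)) + D (e t)"
      and der: "(x has_vector_derivative (A (P t (x t)) + B (e t) + G t (inv (P t) (P t (x t))))) (at t within {0..})"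
      using sol t by (simp_all add: classical_solution_def ndom_S CD_S AB_S)
    show "(P t (x t), e t - K (f t - D (e t))) \<in> ndom S" using dom by (simp add: ndom_S)
    show "f t - D (K (f t - D (e t))) = CD S (P t (x t), e t - K (f t - D (e t)))"
      by (simp add: CD_S f D.diff)
    have "AB S (P t (x t), e t - K (f t - D (e t))) + G' t (inv (P t) (P t (x t)))
        = A (P t (x t)) + B (e t) + G t (inv (P t) (P t (x t)))"
      using bij_is_inj[OF bij[OF t]] by (simp add: AB_S f G'[OF t] B.diff)
    then show "(x has_vector_derivative (AB S (P t (x t), e t - K (f t - D (e t)))
        + G' t (inv (P t) (P t (x t))))) (at t within {0..})"
      using der by simp
  qed
qed

text \<open>The quantity \<open>f - D e\<close> is unchanged by the feedback, so feedback with
  \<open>- K\<close> is the inverse transformation and exchanges the roles of \<open>G\<close> and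
  \<open>G'\<close>.\<close>

lemma classical_solution_feedback_converse:
  assumes K: "bounded_linear K" and sol: "classical_solution S P G' e' x f'"
    and bij: "\<And>t. 0 \<le> t \<Longrightarrow> bij (P t)"
    and G': "\<And>t z. 0 \<le> t \<Longrightarrow> G' t z = G t z + B (K (C (P t z)))"
  shows "classical_solution S P G (\<lambda>t. e' t + K (f' t - D (e' t))) x (\<lambda>t. f' t + D (K (f' t - D (e' t))))"
  using classical_solution_feedback[OF bounded_linear_minus[OF K] sol bij, of G]
  by (simp add: G' B.neg D.neg)

lemma admissible_PG_feedback:
  assumes PG: "admissible_PG X P G" and K: "bounded_op E E K"
  shows "admissible_PG X P (\<lambda>t z. G t z + B (K (C (P t z))))"
proof -
  note Kl = bounded_opD(1)[OF K]
  have BKC: "bounded_linear (\<lambda>z. B (K (C z)))"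
    by (rule bounded_linear_compose[OF B.bounded_linear_axioms bounded_linear_compose[OF Kl C.bounded_linear_axioms]])
  have "bounded_op X X (\<lambda>z. G t z + B (K (C (P t z))))" if t: "0 \<le> t" for t
  proof (intro bounded_opI X.hilbert)
    have P: "bounded_op X X (P t)" and G: "bounded_op X X (G t)"
      using PG t by (simp_all add: admissible_PG_def positive_op_def)
    show "bounded_linear (\<lambda>z. G t z + B (K (C (P t z))))"
      by (rule bounded_linear_add[OF bounded_opD(1)[OF G] bounded_linear_compose[OF BKC bounded_opD(1)[OF P]]])
    show "G t (scal X c z) + B (K (C (P t (scal X c z)))) = scal X c (G t z + B (K (C (P t z))))" for c z
      by (simp add: bounded_opD(2)[OF P] bounded_opD(2)[OF G] bounded_opD(2)[OF B] bounded_opD(2)[OF C]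
          bounded_opD(2)[OF K] X.scale_right_distrib)
  qed
  moreover have "(\<lambda>t. G t z + B (K (C (P t z)))) \<in> C1_fun" for z
    using PG C2_fun_subset_C1_fun
    by (intro C1_fun_add C1_fun_bounded_linear[OF BKC]) (auto simp: admissible_PG_def)
  ultimately show ?thesis using PG by (simp add: admissible_PG_def)
qed

lemma V_cross_eq:
  assumes \<beta>: "0 < rc_re \<beta>" and "bij (P 0)"
  shows "V_cross E id \<beta> S P = inv (P 0) ` domA \<times> H1_loc"
proof -
  have "x0 \<in> inv (P 0) ` domA \<longleftrightarrow> P 0 x0 \<in> domA" for x0
    using assms(2) by (auto simp: image_iff bij_is_surj surj_f_inv_f bij_is_inj
        intro!: bexI[of _ "P 0 x0"])
  then show ?thesis by (auto simp: V_cross_def ndom_S_cross[OF \<beta> refl])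
qed

text \<open>
  The input \<open>(\<beta> I + D) e / sqrt (2 Re \<beta>)\<close> of the scattering system with the modified \<open>G\<close> produces the
  state trajectory of the original system with input \<open>e\<close>.
\<close>

lemma unique_classical_solution_exists:
  assumes \<beta>: "0 < rc_re \<beta>" and PG: "admissible_PG X P G"
    and scattering: "scattering_system E X id \<beta> S P (\<lambda>t z. G t z + B (R \<beta> (C (P t z)))) \<Sigma>"
    and x0: "P 0 x0 \<in> domA" and e: "e \<in> H1_loc"
  shows "\<exists>x f. unique_classical_solution S P G x0 e x f"
proof -
  define \<gamma> where "\<gamma> = sqrt (2 * rc_re \<beta>)"
  note \<gamma> = \<gamma>[OF \<beta> \<gamma>_def]
  define G' where "G' = (\<lambda>t z. G t z + B (R \<beta> (C (P t z))))"
  have bij: "bij (P t)" if "0 \<le> t" for t using PG that by (simp add: admissible_PG_def)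
  note R = R_bounded_linear[OF \<beta>]
  define u where "u = (\<lambda>t. (1 / \<gamma>) *\<^sub>R (scal E \<beta> (e t) + D (e t)))"
  have \<gamma>u: "\<gamma> *\<^sub>R u t = scal E \<beta> (e t) + D (e t)" for t using \<gamma>(3) by (simp add: u_def)
  have "u \<in> H1_loc"
    unfolding u_def
    by (intro H1_loc_bounded_linear[OF bounded_linear_scaleR_right] H1_loc_add
        H1_loc_bounded_linear[OF E.scal_bounded_linear] H1_loc_bounded_linear[OF D.bounded_linear_axioms] e)
  then have "(x0, u) \<in> V_cross E id \<beta> S P"
    using x0 by (simp add: V_cross_def ndom_S_cross[OF \<beta> \<gamma>_def])
  then obtain x y where uniq: "unique_classical_solution (cayley_transform E id \<beta> S) P G' x0 u x y"
    using scattering unfolding scattering_system_def G'_def by blast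
  \<comment> \<open>These are the effort and flow behind the scattering pair \<open>(u, y)\<close>.
    They solve the problem with \<open>G'\<close>; undoing the feedback must give back the
    prescribed \<open>e\<close>.\<close>
  define e' where "e' = (\<lambda>t. (1 / \<gamma>) *\<^sub>R (u t + y t))"
  define f' where "f' = (\<lambda>t. \<gamma> *\<^sub>R u t - scal E \<beta> (e' t))"
  have "\<gamma> *\<^sub>R y t = scal E (rc_conj \<beta>) (e' t) - f' t" for t
  proof -
    have "\<gamma> *\<^sub>R \<gamma> *\<^sub>R e' t = \<gamma> *\<^sub>R u t + \<gamma> *\<^sub>R y t" using \<gamma>(3) by (simp add: e'_def scaleR_add_right)
    then show ?thesis using \<beta>_conj_add[OF \<beta> \<gamma>_def, of "e' t"] by (simp add: f'_def algebra_simps)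
  qed
  moreover have "\<gamma> *\<^sub>R u t = scal E \<beta> (e' t) + f' t" for t by (simp add: f'_def)
  ultimately have "classical_solution S P G' e' x f'"
    using uniq classical_solution_cayley_iff[OF \<beta> \<gamma>_def, of u e' f' y P G' x]
    by (simp add: unique_classical_solution_def)
  from classical_solution_feedback_converse[OF R this bij, of G]
  have "classical_solution S P G (\<lambda>t. e' t + R \<beta> (f' t - D (e' t))) x (\<lambda>t. f' t + D (R \<beta> (f' t - D (e' t))))"
    by (simp add: G'_def)
  moreover have "e' t + R \<beta> (f' t - D (e' t)) = e t" for t
  proof -
    \<comment> \<open>Both \<open>(\<beta> I + D) e\<close> and \<open>\<beta> e' + f'\<close> equal
      \<open>\<gamma> u\<close>, so this is \<open>\<beta> I + D\<close> applied to
      \<open>e - e'\<close>, which \<open>R \<beta>\<close> inverts.\<close>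
    have "f' t - D (e' t) = (scal E \<beta> (e t) + D (e t)) - (scal E \<beta> (e' t) + D (e' t))"
      by (simp add: f'_def \<gamma>u)
    then have "R \<beta> (f' t - D (e' t)) = e t - e' t"
      by (simp only: linear_diff[OF bounded_linear.linear[OF R]] R_\<beta>_D[OF \<beta>])
    then show ?thesis by simp
  qed
  ultimately obtain f where sol: "classical_solution S P G e x f" by auto
  have "x2 t = x t \<and> f2 t = f t"
    if sol2: "classical_solution S P G e x2 f2" and x2: "x2 0 = x0" and t: "0 \<le> t" for x2 f2 t
  proof -
    define e2 where "e2 = (\<lambda>t. e t - R \<beta> (f2 t - D (e t)))"
    define h2 where "h2 = (\<lambda>t. f2 t - D (R \<beta> (f2 t - D (e t))))"
    define y2 where "y2 = (\<lambda>t. (1 / \<gamma>) *\<^sub>R (scal E (rc_conj \<beta>) (e2 t) - h2 t))"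
    have "classical_solution S P G' e2 x2 h2"
      unfolding e2_def h2_def by (rule classical_solution_feedback[OF R sol2 bij]) (simp_all add: G'_def)
    \<comment> \<open>The terms containing \<open>f2\<close> cancel: the competing solution has the
      same input \<open>u\<close>, so uniqueness for the scattering problem applies to its state.
      Its flow is then fixed by the output equation.\<close>
    moreover have "\<gamma> *\<^sub>R u t = scal E \<beta> (e2 t) + h2 t" for t
      using \<beta>_D_R[OF \<beta>, of "f2 t - D (e t)"]
      by (simp add: \<gamma>u e2_def h2_def E.scale_right_diff_distrib algebra_simps)
    moreover have "\<gamma> *\<^sub>R y2 t = scal E (rc_conj \<beta>) (e2 t) - h2 t" for t
      using \<gamma>(3) by (simp add: y2_def)
    ultimately have "classical_solution (cayley_transform E id \<beta> S) P G' u x2 y2"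
      using classical_solution_cayley_iff[OF \<beta> \<gamma>_def, of u e2 h2 y2 P G' x2] by simp
    then have "x2 t = x t" using uniq x2 t unfolding unique_classical_solution_def by blast
    then show ?thesis using sol sol2 t by (simp add: classical_solution_def)
  qed
  then show ?thesis using sol uniq unfolding unique_classical_solution_def by blast
qed

text \<open>A limit has the form \<open>(\<gamma> x0, u + y)\<close>. It stays in
  \<open>V_cross\<close> because \<open>u\<close> and \<open>y\<close> are both
  \<open>H1_loc\<close> and \<open>domA\<close> is a subspace; conversely, reaching a given pair
  means solving the original problem with prescribed effort, hence the hypothesis
  \<open>solvable\<close>.\<close>

lemma V_limit_eq:
  assumes \<beta>: "0 < rc_re \<beta>" and PG: "admissible_PG X P G"
    and scattering: "scattering_system E X id \<beta> S P G \<Sigma>"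
    and solvable: "\<And>x0 e. P 0 x0 \<in> domA \<Longrightarrow> e \<in> H1_loc \<Longrightarrow> \<exists>x f. unique_classical_solution S P G x0 e x f"
  shows "V_limit E id \<beta> S P \<Sigma> = to_L2_loc ` V_cross E id \<beta> S P"
proof -
  define \<gamma> where "\<gamma> = sqrt (2 * rc_re \<beta>)"
  note \<gamma> = \<gamma>[OF \<beta> \<gamma>_def]
  interpret P0: bounded_linear "P 0"
    using PG by (auto simp: admissible_PG_def positive_op_def intro: bounded_opD)
  have V: "(x0, u) \<in> V_cross E id \<beta> S P \<longleftrightarrow> u \<in> H1_loc \<and> P 0 x0 \<in> domA" for x0 u
    by (simp add: V_cross_def ndom_S_cross[OF \<beta> \<gamma>_def])
  have scaled: "P 0 (r *\<^sub>R x0) \<in> domA" if "P 0 x0 \<in> domA" for r x0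
    using that by (simp add: P0.scaleR subspace_scale[OF subspace_domA(2)])
  show ?thesis
  proof (intro set_eqI iffI)
    fix p assume "p \<in> V_limit E id \<beta> S P \<Sigma>"
    then obtain x0 u v where p: "p = to_L2_loc (\<gamma> *\<^sub>R x0, v)" and xu: "(x0, u) \<in> V_cross E id \<beta> S P"
      and v: "v \<in> L2_loc" "tendsto_L2_loc (\<lambda>t s. obsv \<Sigma> t 0 x0 s + u s + inout \<Sigma> t 0 (trunc 0 t u) s) v"
      by (auto simp: V_limit_def \<gamma>_def)
    obtain x y where sol: "unique_classical_solution (cayley_transform E id \<beta> S) P G x0 u x y"
        "mild_solution \<Sigma> x0 u x y"
      using scattering xu unfolding scattering_system_def by blast
    have "ae_eq v (\<lambda>s. u s + y s)" using v tendsto_L2_loc_mild_solution_iff[OF sol(2)] by blast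
    then have "p = to_L2_loc (\<gamma> *\<^sub>R x0, \<lambda>s. u s + y s)"
      by (simp add: p to_L2_loc_def ae_class_eq_iff)
    moreover have "(\<gamma> *\<^sub>R x0, \<lambda>s. u s + y s) \<in> V_cross E id \<beta> S P"
      using xu sol(1) by (auto simp: V unique_classical_solution_def classical_solution_def
          intro: H1_loc_add scaled)
    ultimately show "p \<in> to_L2_loc ` V_cross E id \<beta> S P" by blast
  next
    fix p assume "p \<in> to_L2_loc ` V_cross E id \<beta> S P"
    then obtain x1 w where p: "p = to_L2_loc (x1, w)" and w: "w \<in> H1_loc" and x1: "P 0 x1 \<in> domA"
      using V by force
    \<comment> \<open>As the limit is \<open>(\<gamma> x0, \<gamma> e)\<close>, the target
      \<open>(x1, w)\<close> dictates \<open>x0 = x1 / \<gamma>\<close> and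
      \<open>e = w / \<gamma>\<close>.\<close>
    define x0 where "x0 = (1 / \<gamma>) *\<^sub>R x1"
    have x0: "P 0 x0 \<in> domA" "\<gamma> *\<^sub>R x0 = x1" using x1 \<gamma>(3) scaled by (simp_all add: x0_def)
    define e where "e = (\<lambda>t. (1 / \<gamma>) *\<^sub>R w t)"
    have e: "e \<in> H1_loc" unfolding e_def by (rule H1_loc_bounded_linear[OF bounded_linear_scaleR_right w])
    obtain x f where "unique_classical_solution S P G x0 e x f" using solvable[OF x0(1) e] by blast
    then have sol: "classical_solution S P G e x f" "x 0 = x0"
      by (simp_all add: unique_classical_solution_def)
    define u where "u = (\<lambda>t. (1 / \<gamma>) *\<^sub>R (scal E \<beta> (e t) + f t))"
    define y where "y = (\<lambda>t. (1 / \<gamma>) *\<^sub>R (scal E (rc_conj \<beta>) (e t) - f t))"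
    have \<gamma>u: "\<gamma> *\<^sub>R u t = scal E \<beta> (e t) + f t" and \<gamma>y: "\<gamma> *\<^sub>R y t = scal E (rc_conj \<beta>) (e t) - f t" for t
      using \<gamma>(3) by (simp_all add: u_def y_def)
    have uy: "u t + y t = w t" for t
    proof -
      have "\<gamma> *\<^sub>R (u t + y t) = \<gamma> *\<^sub>R w t"
        using \<gamma>(3) unfolding scaleR_add_right \<gamma>u \<gamma>y
        by (simp add: \<beta>_conj_add[OF \<beta> \<gamma>_def, of "e t"]) (simp add: e_def)
      then show ?thesis using \<gamma>(3) by simp
    qed
    have sol': "classical_solution (cayley_transform E id \<beta> S) P G u x y"
      using sol(1) classical_solution_cayley_iff[OF \<beta> \<gamma>_def, of u e f y P G x] \<gamma>u \<gamma>y by simp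
    then have xu: "(x0, u) \<in> V_cross E id \<beta> S P" using x0(1) by (simp add: V classical_solution_def)
    then obtain x' y' where uniq: "unique_classical_solution (cayley_transform E id \<beta> S) P G x0 u x' y'"
        and mild: "mild_solution \<Sigma> x0 u x' y'"
      using scattering unfolding scattering_system_def by blast
    \<comment> \<open>The mild solution comes with its own output \<open>y'\<close>; uniqueness of
      the classical solution identifies it with the \<open>y\<close> built from
      \<open>(e, f)\<close>.\<close>
    have "y' t = y t" if "0 \<le> t" for t
      using uniq sol' sol(2) that unfolding unique_classical_solution_def by metis
    then have "ae_eq w (\<lambda>s. u s + y' s)" by (simp add: ae_eq_iff uy)
    then have "tendsto_L2_loc (\<lambda>t s. obsv \<Sigma> t 0 x0 s + u s + inout \<Sigma> t 0 (trunc 0 t u) s) w"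
      using tendsto_L2_loc_mild_solution_iff[OF mild] w H1_loc_subset_L2_loc by blast
    then show "p \<in> V_limit E id \<beta> S P \<Sigma>"
      unfolding V_limit_def using xu w H1_loc_subset_L2_loc
      by (intro CollectI exI[of _ x0] exI[of _ u] exI[of _ w]) (auto simp: p x0(2) simp flip: \<gamma>_def)
  qed
qed

end

theorem theoremV2:
  fixes E :: "('k::rc_scalar, 'e::banach) inner_structure"
    and X :: "('k, 'x::banach) inner_structure"
    and domA :: "'x set"
    and A :: "'x \<Rightarrow> 'x" and B :: "'e \<Rightarrow> 'x" and C :: "'x \<Rightarrow> 'e" and D :: "'e \<Rightarrow> 'e"
    and S :: "('x, 'e, 'e) node"
  assumes "hilbert_space E" and "hilbert_space X"
    and "linear_op X X domA A"
    and "bounded_op E X B" and "bounded_op X E C" and "bounded_op E E D"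
    and "S = bounded_node domA A B C D"
    and "dirac_node E X E id S"
  shows "system_node E X E S \<and>
    (\<forall>\<Sigma> P G \<beta>.
       scattering_family E X id S \<Sigma> \<and>
       admissible_PG X P G \<and> 0 < rc_re \<beta> \<and> cayley_injective E id \<beta> S \<longrightarrow>
         V_limit E id \<beta> S P (\<Sigma> \<beta> P G) = to_L2_loc ` V_cross E id \<beta> S P \<and>
         V_cross E id \<beta> S P = inv (P 0) ` domA \<times> H1_loc \<and>
         (\<forall>x0 \<in> inv (P 0) ` domA. \<forall>e \<in> H1_loc. \<exists>x f.
            unique_classical_solution S P G x0 e x f))"
proof -
  interpret node: bounded_dirac_node E X domA A B C D
    using assms by unfold_locales simp_all
  have "V_limit E id \<beta> node.S P (\<Sigma> \<beta> P G) = to_L2_loc ` V_cross E id \<beta> node.S P \<and>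
      V_cross E id \<beta> node.S P = inv (P 0) ` domA \<times> H1_loc \<and>
      (\<forall>x0 \<in> inv (P 0) ` domA. \<forall>e \<in> H1_loc. \<exists>x f. unique_classical_solution node.S P G x0 e x f)"
    if family: "scattering_family E X id node.S \<Sigma>" and PG: "admissible_PG X P G"
      and \<beta>: "0 < rc_re \<beta>" "cayley_injective E id \<beta> node.S" for \<Sigma> P G \<beta>
  proof (intro conjI)
    have bij: "bij (P 0)" using PG by (simp add: admissible_PG_def)
    have scattering: "scattering_system E X id \<beta> node.S P H (\<Sigma> \<beta> P H)" if "admissible_PG X P H" for H
      using family \<beta> that unfolding scattering_family_def by blast
    \<comment> \<open>Here the scattering family is evaluated at the multiplier containing the
      feedback term, whereas the limit space below uses its value at \<open>G\<close>.\<close>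
    have solvable: "\<exists>x f. unique_classical_solution node.S P G x0 e x f"
      if "P 0 x0 \<in> domA" "e \<in> H1_loc" for x0 e
      by (rule node.unique_classical_solution_exists[OF \<beta>(1) PG
          scattering[OF node.admissible_PG_feedback[OF PG node.R_bounded_op[OF \<beta>(1)]]] that])
    show "V_limit E id \<beta> node.S P (\<Sigma> \<beta> P G) = to_L2_loc ` V_cross E id \<beta> node.S P"
    proof (rule node.V_limit_eq[OF \<beta>(1) PG scattering[OF PG]])
      fix x0 and e :: "real \<Rightarrow> 'e" assume "P 0 x0 \<in> domA" "e \<in> H1_loc"
      then show "\<exists>x f. unique_classical_solution node.S P G x0 e x f" by (rule solvable)
    qed
    show "V_cross E id \<beta> node.S P = inv (P 0) ` domA \<times> H1_loc"
      by (intro node.V_cross_eq \<beta>(1) bij)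
    show "\<forall>x0 \<in> inv (P 0) ` domA. \<forall>e \<in> H1_loc. \<exists>x f. unique_classical_solution node.S P G x0 e x f"
    proof (intro ballI)
      fix x0 and e :: "real \<Rightarrow> 'e" assume "x0 \<in> inv (P 0) ` domA" "e \<in> H1_loc"
      then show "\<exists>x f. unique_classical_solution node.S P G x0 e x f"
        using bij by (intro solvable) (auto simp: bij_is_surj surj_f_inv_f)
    qed
  qed
  then show ?thesis
    using node.system_node unfolding \<open>S = bounded_node domA A B C D\<close> by blast
qed

end
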